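(* For all integers $n,k,i,j\ge 0$ let $\overline{C}_3(n;k;i,j)$ denote the number of jagged overpartitions of $n$ (as defined in the context) with exactly $k$ non-overlined parts, exactly $i$ parts of color $a$ and exactly $j$ parts of color $b$, satisfying the additional condition that the final $t$ parts are overlined, where $t$ is the number of parts of color $u$. Then $$\sum_{n,k,i,j \geq 0} \overline{C}_3(n;k;i,j) a^ib^jq^n = \frac{(-q;q)_{\infty}(-aq;q)_{\infty}(-bq;q)_{\infty}}{(abq;q^2)_{\infty}}.$$
   Context: Notation: $(x;q)_n=\prod_{m=0}^{n-1}(1-xq^m)$ for $n\in\mathbb{N}\cup\{\infty\}$. A jagged overpartition of $n$ is a finite sequence $(\lambda_1,\dots,\lambda_s)$ of non-negative integers with sum $n$, where each part carries one of three colors $a$, $b$, $u$, the final occurrence of a positive part may be overlined (zero parts are never overlined), the last part satisfies $\lambda_s\notin\{0_a,0_b,\overline{1}_a,\overline{1}_b\}$, and for each $i$ the difference $\lambda_i-\lambda_{i+1}$ is at least the entry of the following matrix in the row given by the type of $\lambda_i$ and the column given by the type of $\lambda_{i+1}$ (types: $\overline{a},\overline{b},\overline{u}$ for overlined parts of colors $a,b,u$; $a,b,u$ for non-overlined ones), columns in the order $\overline{a},\overline{b},\overline{u},a,b,u$: row $\overline{a}$: $2,0,2,2,0,2$; row $\overline{b}$: $2,2,3,2,2,3$; row $\overline{u}$: $1,0,1,1,0,1$; row $a$: $1,-1,1,1,-1,1$; row $b$: $1,1,2,1,1,2$; row $u$: $0,-1,0,0,-1,0$. Non-overlined parts include parts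 equal to $0$. *)

theory Defs
  imports "HOL-Analysis.Analysis" "HOL-Computational_Algebra.Formal_Power_Series"
begin

datatype color = Color_a | Color_b | Color_u

datatype part = Part (part_size: nat) (part_color: color) (overlined: bool)

fun type_index :: "part \<Rightarrow> nat" where
  "type_index (Part v Color_a True) = 0"
| "type_index (Part v Color_b True) = 1"
| "type_index (Part v Color_u True) = 2"
| "type_index (Part v Color_a False) = 3"
| "type_index (Part v Color_b False) = 4"
| "type_index (Part v Color_u False) = 5"

definition diff_matrix :: "int list list" where
  "diff_matrix =
    [[2,  0, 2, 2,  0, 2],
     [2,  2, 3, 2,  2, 3],
     [1,  0, 1, 1,  0, 1],
     [1, -1, 1, 1, -1, 1],
     [1,  1, 2, 1,  1, 2],
     [0, -1, 0, 0, -1, 0]]"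

definition min_diff :: "part \<Rightarrow> part \<Rightarrow> int" where
  "min_diff x y = diff_matrix ! type_index x ! type_index y"

text \<open>
  A part is a colored integer: two parts of equal size and different colors are occurrences of
  different parts, so an overlined $v_a$ may be followed by a part $v_b$, in agreement with
  the zero entries of the matrix. The empty sequence is a jagged overpartition of 0.
\<close>

definition jagged_overpartition :: "nat \<Rightarrow> part list \<Rightarrow> bool" where
  "jagged_overpartition n xs \<longleftrightarrow>
     sum_list (map part_size xs) = n \<and>
     (\<forall>l < length xs. overlined (xs ! l) \<longrightarrow>
        part_size (xs ! l) > 0 \<and>
        (\<forall>m. l < m \<and> m < length xs \<longrightarrow>
           \<not> (part_size (xs ! m) = part_size (xs ! l) \<and>
              part_color (xs ! m) = part_color (xs ! l)))) \<and>
     (xs \<noteq> [] \<longrightarrow> last xs \<notin>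
        {Part 0 Color_a False, Part 0 Color_b False, Part 1 Color_a True, Part 1 Color_b True}) \<and>
     (\<forall>l. Suc l < length xs \<longrightarrow>
        int (part_size (xs ! l)) - int (part_size (xs ! Suc l))
          \<ge> min_diff (xs ! l) (xs ! Suc l))"

definition num_color :: "color \<Rightarrow> part list \<Rightarrow> nat" where
  "num_color c xs = length (filter (\<lambda>x. part_color x = c) xs)"

definition num_non_overlined :: "part list \<Rightarrow> nat" where
  "num_non_overlined xs = length (filter (\<lambda>x. \<not> overlined x) xs)"

definition final_overlined :: "nat \<Rightarrow> part list \<Rightarrow> bool" where
  "final_overlined t xs \<longleftrightarrow> (\<forall>x \<in> set (drop (length xs - t) xs). overlined x)"

definition C3_set :: "nat \<Rightarrow> nat \<Rightarrow> nat \<Rightarrow> nat \<Rightarrow> part list set" where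
  "C3_set n k i j =
     {xs. jagged_overpartition n xs \<and> num_non_overlined xs = k \<and>
          num_color Color_a xs = i \<and> num_color Color_b xs = j \<and>
          final_overlined (num_color Color_u xs) xs}"

definition C3 :: "nat \<Rightarrow> nat \<Rightarrow> nat \<Rightarrow> nat \<Rightarrow> nat" where
  "C3 n k i j = card (C3_set n k i j)"

text \<open>The cardinality in the definition of \<open>C3\<close> is a genuine one:\<close>

lemma finite_C3_set: "finite (C3_set n k i j)"
proof -
  define P where "P = (\<lambda>(v, c, d). Part v c d) `
    ({..n} \<times> {Color_a, Color_b, Color_u} \<times> (UNIV :: bool set))"
  have fin: "finite P" unfolding P_def by simp
  have "C3_set n k i j \<subseteq> {xs. set xs \<subseteq> P \<and> length xs \<le> n + k}"
  proof
    fix xs assume "xs \<in> C3_set n k i j"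
    then have jag: "jagged_overpartition n xs" and k: "num_non_overlined xs = k"
      by (auto simp: C3_set_def)
    have sum: "sum_list (map part_size xs) = n"
      using jag by (simp add: jagged_overpartition_def)
    have pos: "part_size x > 0" if x: "x \<in> set xs" "overlined x" for x
    proof -
      obtain l where "l < length xs" "xs ! l = x"
        using x(1) by (auto simp: in_set_conv_nth)
      then show ?thesis using jag x(2) by (auto simp: jagged_overpartition_def)
    qed
    have "set xs \<subseteq> P"
    proof
      fix x assume x: "x \<in> set xs"
      have "part_size x \<le> n"
        using member_le_sum_list[of "part_size x" "map part_size xs"] x sum by simp
      moreover obtain v c d where "x = Part v c d" by (cases x)
      moreover have "c \<in> {Color_a, Color_b, Color_u}" by (cases c) auto
      ultimately show "x \<in> P" by (auto simp: P_def image_iff)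
    qed
    moreover have len: "length ys \<le> sum_list (map part_size ys) + num_non_overlined ys"
      if "\<forall>y \<in> set ys. overlined y \<longrightarrow> part_size y > 0" for ys
      using that by (induction ys) (auto simp: num_non_overlined_def)
    have "length xs \<le> n + k" using len[of xs] pos sum k by simp
    ultimately show "xs \<in> {xs. set xs \<subseteq> P \<and> length xs \<le> n + k}" by simp
  qed
  then show ?thesis using finite_lists_length_le[OF fin] finite_subset by blast
qed

definition qpoch_inf :: "'a::{t2_space, comm_ring_1} \<Rightarrow> 'a \<Rightarrow> 'a" where
  "qpoch_inf x q = prodinf (\<lambda>m. 1 - x * q ^ m)"

text \<open>
  The indeterminates of the ring of formal power series in $q$ over formal power series in $b$
  over formal power series in $a$, with rational coefficients. Infinite sums and products in this
  ring refer to the library topology of the outermost layer, the $q$-adic one, with the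
  coefficients of the powers of $q$ carrying the discrete topology.
\<close>

definition ser_a :: "rat fps fps fps" where "ser_a = fps_const (fps_const fps_X)"
definition ser_b :: "rat fps fps fps" where "ser_b = fps_const fps_X"
definition ser_q :: "rat fps fps fps" where "ser_q = fps_X"

end

theory Submission
  imports Defs
begin

text \<open>
  Subtract 1 from each part of color \<open>b\<close>, and record the slack of each difference condition. For a
  fixed word of colors of length \<open>s\<close> the slacks are arbitrary and contribute \<open>1/(q;q)_s\<close>, while the
  overlines, of which the last \<open>t\<close> are forced, contribute \<open>(-q;q)_n q^(tn + t(t+1)/2)\<close> with \<open>n = i + j\<close>.
  Let \<open>g(i,j,t)\<close> be the sum over color words of \<open>q\<close> to the minimal size, divided by \<open>(q;q)_s\<close>.
  Removing the last letter gives recursions whose solution has generating function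
  \<open>g(a,b,v) = (1 + aq)(1 + bq) / ((1 - v)(1 - abq)) g(aq,bq,vq)\<close>.
  Hence \<open>g(i,j,t) = p(i,j) / (q;q)_t\<close>, where \<open>p\<close> has the generating function
  \<open>(-aq;q)(-bq;q) / (abq;q^2)\<close> (infinite products), and Euler's identity for \<open>(-q^(n+1);q)\<close> sums over \<open>t\<close> to the
  remaining factor \<open>(-q;q)\<close>, independently of \<open>n\<close>.
\<close>

unbundle no vec_syntax
unbundle fps_syntax

section \<open>Color words\<close>

abbreviation Q :: "rat fps" where "Q \<equiv> fps_X"

text \<open>
  After subtracting 1 from every part of color \<open>b\<close>, the entry of the difference matrix for an
  overlined part is one more than that for the same color without the overline, and the remaining
  bounds are the following. They make the shifted parts weakly decreasing.
\<close>

fun color_gap :: "color \<Rightarrow> color \<Rightarrow> nat" where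
  "color_gap Color_a y = (if y = Color_b then 0 else 1)"
| "color_gap Color_b y = (if y = Color_a then 0 else 1)"
| "color_gap Color_u y = 0"

definition first_color :: "color list \<Rightarrow> color \<Rightarrow> color" where
  "first_color w e = (case w of [] \<Rightarrow> e | c # _ \<Rightarrow> c)"

text \<open>
  The condition on the last part says that it could be followed by a (shifted) part 0 of
  color \<open>a\<close>, so words come with a terminal color \<open>e\<close>, which is \<open>a\<close> for actual overpartitions;
  the other terminal colors are needed for the recursion on the last letter. A unit of difference
  after the \<open>l\<close>-th part raises \<open>l\<close> parts, hence the factor \<open>k\<close>.
\<close>

fun word_weight :: "nat \<Rightarrow> color \<Rightarrow> color list \<Rightarrow> nat" where
  "word_weight k e [] = 0"
| "word_weight k e (c # w) =
     of_bool (c = Color_b) + k * color_gap c (first_color w e) + word_weight (Suc k) e w"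

text \<open>The appended letter becomes the terminal color seen by \<open>w\<close>. It stands in
  position \<open>k + length w\<close>, which is the factor of its own gap before
  \<open>e\<close>.\<close>

lemma word_weight_snoc:
  "word_weight k e (w @ [x]) =
     word_weight k x w + of_bool (x = Color_b) + (k + length w) * color_gap x e"
  by (induction w arbitrary: k) (auto simp: first_color_def split: list.splits)

text \<open>
  Integer arguments make the recursions below hold without case distinctions at 0.
\<close>

definition words :: "int \<Rightarrow> int \<Rightarrow> int \<Rightarrow> color list set" where
  "words i j t = {w. int (count_list w Color_a) = i \<and> int (count_list w Color_b) = j \<and>
     int (count_list w Color_u) = t}"

lemma UNIV_color: "(UNIV :: color set) = {Color_a, Color_b, Color_u}"
  by (auto intro: color.exhaust)

lemma length_eq_sum_counts:
  "length w = count_list w Color_a + count_list w Color_b + count_list w Color_u"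
proof (induction w)
  case (Cons c w) then show ?case by (cases c) auto
qed simp

lemma words_length: "w \<in> words i j t \<Longrightarrow> int (length w) = i + j + t"
  by (auto simp: words_def length_eq_sum_counts)

lemma finite_words: "finite (words i j t)"
proof (rule finite_subset)
  show "words i j t \<subseteq> {w. set w \<subseteq> UNIV \<and> length w = nat (i + j + t)}"
    using words_length by force
  show "finite {w. set w \<subseteq> (UNIV :: color set) \<and> length w = nat (i + j + t)}"
    by (rule finite_lists_length_eq) (simp add: UNIV_color)
qed

lemma words_neg: "i < 0 \<or> j < 0 \<or> t < 0 \<Longrightarrow> words i j t = {}"
  by (auto simp: words_def)

lemma words_snoc:
  "words i j t =
     (\<lambda>w. w @ [Color_a]) ` words (i - 1) j t \<union> (\<lambda>w. w @ [Color_b]) ` words i (j - 1) t \<union>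
     (\<lambda>w. w @ [Color_u]) ` words i j (t - 1) \<union> (if i = 0 \<and> j = 0 \<and> t = 0 then {[]} else {})"
  (is "_ = ?R")
proof (intro set_eqI iffI)
  fix w assume w: "w \<in> words i j t"
  show "w \<in> ?R"
  proof (cases w rule: rev_exhaust)
    case Nil with w show ?thesis by (auto simp: words_def)
  next
    case (snoc w' c)
    with w have "(c = Color_a \<longrightarrow> w' \<in> words (i - 1) j t) \<and> (c = Color_b \<longrightarrow> w' \<in> words i (j - 1) t) \<and>
        (c = Color_u \<longrightarrow> w' \<in> words i j (t - 1))"
      by (auto simp: words_def)
    with snoc show ?thesis by (cases c) auto
  qed
next
  fix w assume "w \<in> ?R" then show "w \<in> words i j t"
    by (auto simp: words_def split: if_splits)
qed

section \<open>Generating functions of color words and their recursion on the last letter\<close>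

definition word_gf :: "color \<Rightarrow> int \<Rightarrow> int \<Rightarrow> int \<Rightarrow> rat fps" where
  "word_gf e i j t = (\<Sum>w\<in>words i j t. Q ^ word_weight 1 e w)"

lemma word_gf_neg: "i < 0 \<or> j < 0 \<or> t < 0 \<Longrightarrow> word_gf e i j t = 0"
  by (simp add: word_gf_def words_neg)

text \<open>Words are sorted by their last letter. A final \<open>Color_u\<close> has gap 0 before
  every color and no shift, hence carries no power of \<open>Q\<close>; the last summand is the
  empty word.\<close>

lemma word_gf_rec:
  "word_gf e i j t =
     Q ^ (nat (i + j + t) * color_gap Color_a e) * word_gf Color_a (i - 1) j t +
     Q ^ (1 + nat (i + j + t) * color_gap Color_b e) * word_gf Color_b i (j - 1) t +
     word_gf Color_u i j (t - 1) + of_bool (i = 0 \<and> j = 0 \<and> t = 0)"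
proof -
  let ?f = "\<lambda>w. Q ^ word_weight 1 e w"
  let ?A = "(\<lambda>w. w @ [Color_a]) ` words (i - 1) j t"
  let ?B = "(\<lambda>w. w @ [Color_b]) ` words i (j - 1) t"
  let ?U = "(\<lambda>w. w @ [Color_u]) ` words i j (t - 1)"
  let ?N = "if i = 0 \<and> j = 0 \<and> t = 0 then {[]} else {}"
  have step: "sum ?f ((\<lambda>w. w @ [c]) ` words i' j' t') =
      Q ^ (of_bool (c = Color_b) + nat (i + j + t) * color_gap c e) * word_gf c i' j' t'"
    if "i' + j' + t' + 1 = i + j + t" for c i' j' t'
  proof -
    have "sum ?f ((\<lambda>w. w @ [c]) ` words i' j' t') = (\<Sum>w\<in>words i' j' t'. ?f (w @ [c]))"
      by (subst sum.reindex) (auto simp: inj_on_def)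
    also have "\<dots> = (\<Sum>w\<in>words i' j' t'.
        Q ^ (of_bool (c = Color_b) + nat (i + j + t) * color_gap c e) * Q ^ word_weight 1 c w)"
    proof (rule sum.cong[OF refl])
      fix w assume "w \<in> words i' j' t'"
      from words_length[OF this] have "1 + length w = nat (i + j + t)" using that by simp
      then show "?f (w @ [c]) =
          Q ^ (of_bool (c = Color_b) + nat (i + j + t) * color_gap c e) * Q ^ word_weight 1 c w"
        by (simp only: word_weight_snoc power_add) (simp add: ac_simps)
    qed
    finally show ?thesis by (simp add: word_gf_def sum_distrib_left)
  qed
  have "word_gf e i j t = sum ?f (?A \<union> ?B \<union> ?U \<union> ?N)"
    unfolding word_gf_def by (subst words_snoc) (rule refl)
  also have "\<dots> = sum ?f ?A + sum ?f ?B + sum ?f ?U + sum ?f ?N"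
    by (subst sum.union_disjoint; (auto simp: finite_words)?)+
  also have "sum ?f ?N = of_bool (i = 0 \<and> j = 0 \<and> t = 0)" by simp
  also have "sum ?f ?A = Q ^ (nat (i + j + t) * color_gap Color_a e) * word_gf Color_a (i - 1) j t"
    by (subst step) simp_all
  also have "sum ?f ?B = Q ^ (1 + nat (i + j + t) * color_gap Color_b e) * word_gf Color_b i (j - 1) t"
    by (subst step) simp_all
  also have "sum ?f ?U = word_gf Color_u i j (t - 1)"
    by (subst step) simp_all
  finally show ?thesis .
qed

section \<open>The q-factorials and their inverses\<close>

definition qfac :: "nat \<Rightarrow> rat fps" where
  "qfac n = (\<Prod>l=1..n. 1 - Q ^ l)"

lemma one_minus_Q_power_nz: "0 < l \<Longrightarrow> 1 - Q ^ l \<noteq> 0"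
  by (rule fps_nonzeroI[of _ 0]) simp

lemma qfac_0 [simp]: "qfac 0 = 1" by (simp add: qfac_def)

lemma qfac_Suc: "qfac (Suc n) = (1 - Q ^ Suc n) * qfac n"
  by (simp add: qfac_def mult.commute)

definition iqfac :: "nat \<Rightarrow> rat fps" where "iqfac n = inverse (qfac n)"

lemma iqfac_Suc: "(1 - Q ^ Suc n) * iqfac (Suc n) = iqfac n"
proof -
  have "fps_nth (1 - Q ^ Suc n) 0 \<noteq> 0" by simp
  then show ?thesis
    unfolding iqfac_def qfac_Suc fps_inverse_mult mult.assoc[symmetric]
    by (subst inverse_mult_eq_1') simp_all
qed

lemma iqfac_0 [simp]: "iqfac 0 = 1" by (simp add: iqfac_def)

section \<open>Quotients by the q-factorial and their functional equation\<close>

definition word_quot :: "color \<Rightarrow> int \<Rightarrow> int \<Rightarrow> int \<Rightarrow> rat fps" where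
  "word_quot e i j t = word_gf e i j t * iqfac (nat (i + j + t))"

lemma word_quot_neg: "i < 0 \<or> j < 0 \<or> t < 0 \<Longrightarrow> word_quot e i j t = 0"
  by (simp add: word_quot_def word_gf_neg)

lemma word_quot_0: "word_quot Color_a 0 0 0 = 1"
  by (simp add: word_quot_def word_gf_rec[of _ 0 0 0] word_gf_neg)

text \<open>The factor \<open>1 - Q ^ nat s\<close> cancels the last factor of the q-factorial. For
  \<open>s\<close> below 1 the conversion \<open>nat\<close> truncates, but then one index is
  negative and both sides vanish.\<close>

lemma iqfac_step: "i' + j' + t' + 1 = (s::int) \<Longrightarrow>
   word_gf e i' j' t' * iqfac (nat s) * (1 - Q ^ nat s) = word_quot e i' j' t'"
proof -
  assume s: "i' + j' + t' + 1 = s"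
  show ?thesis
  proof (cases "s \<ge> 1")
    case True
    then have "nat s = Suc (nat (i' + j' + t'))" using s by simp
    then show ?thesis using iqfac_Suc[of "nat (i' + j' + t')"]
      by (simp add: word_quot_def mult_ac)
  next
    case False
    then have "i' < 0 \<or> j' < 0 \<or> t' < 0" using s by linarith
    then show ?thesis by (simp add: word_gf_neg word_quot_neg)
  qed
qed

text \<open>Replacing the terminal color \<open>a\<close> by \<open>b\<close> removes the gap after
  a final \<open>a\<close> and creates one after a final \<open>b\<close>. Both changes are
  multiples of \<open>1 - Q ^ s\<close>, with \<open>s\<close> the length, so
  \<open>iqfac_step\<close> applies.\<close>

lemma word_quot_b: "word_quot Color_b i j t = word_quot Color_a i j t + word_quot Color_a (i-1) j t - Q * word_quot Color_b i (j-1) t"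
proof -
  let ?s = "nat (i + j + t)"
  have "word_gf Color_b i j t = word_gf Color_a i j t + (1 - Q ^ ?s) * word_gf Color_a (i - 1) j t
      - Q * (1 - Q ^ ?s) * word_gf Color_b i (j - 1) t"
    unfolding word_gf_rec[of Color_b i j t] word_gf_rec[of Color_a i j t]
    by (simp add: algebra_simps)
  note E = this
  have "word_quot Color_b i j t = word_quot Color_a i j t +
      word_gf Color_a (i - 1) j t * iqfac ?s * (1 - Q ^ ?s)
      - Q * (word_gf Color_b i (j - 1) t * iqfac ?s * (1 - Q ^ ?s))"
    unfolding word_quot_def E by (simp add: algebra_simps)
  then show ?thesis by (simp add: iqfac_step)
qed

text \<open>As for terminal color \<open>b\<close>, except that a final \<open>a\<close> keeps its
  gap, so only the words ending in \<open>b\<close> change.\<close>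

lemma word_quot_u: "word_quot Color_u i j t = word_quot Color_a i j t - Q * word_quot Color_b i (j-1) t"
proof -
  let ?s = "nat (i + j + t)"
  have "word_gf Color_u i j t = word_gf Color_a i j t
      - Q * (1 - Q ^ ?s) * word_gf Color_b i (j - 1) t"
    unfolding word_gf_rec[of Color_u i j t] word_gf_rec[of Color_a i j t]
    by (simp add: algebra_simps)
  note E = this
  have "word_quot Color_u i j t = word_quot Color_a i j t
      - Q * (word_gf Color_b i (j - 1) t * iqfac ?s * (1 - Q ^ ?s))"
    unfolding word_quot_def E by (simp add: algebra_simps)
  then show ?thesis by (simp add: iqfac_step)
qed

lemma word_quot_a: "(1 - Q ^ nat (i + j + t)) * word_quot Color_a i j t =
   Q ^ nat (i + j + t) * word_quot Color_a (i-1) j t + Q * word_quot Color_b i (j-1) t + word_quot Color_u i j (t-1)"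
proof -
  let ?s = "nat (i + j + t)"
  \<comment> \<open>The factor also kills the term of the empty word, which occurs only for
    \<open>?s = 0\<close>.\<close>
  have "word_gf Color_a i j t * (1 - Q ^ ?s) = (Q ^ ?s * word_gf Color_a (i - 1) j t +
      Q * word_gf Color_b i (j - 1) t + word_gf Color_u i j (t - 1)) * (1 - Q ^ ?s)"
    unfolding word_gf_rec[of Color_a i j t] by (auto simp: algebra_simps)
  note E = this
  have "(1 - Q ^ ?s) * word_quot Color_a i j t = (word_gf Color_a i j t * (1 - Q ^ ?s)) * iqfac ?s"
    by (simp add: word_quot_def)
  also have "\<dots> =
     Q ^ ?s * (word_gf Color_a (i - 1) j t * iqfac ?s * (1 - Q ^ ?s))
      + Q * (word_gf Color_b i (j - 1) t * iqfac ?s * (1 - Q ^ ?s))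
      + (word_gf Color_u i j (t - 1) * iqfac ?s * (1 - Q ^ ?s))"
    unfolding E by (simp add: algebra_simps)
  finally show ?thesis by (simp add: iqfac_step)
qed

lemma Q_pow_shift:
  fixes f :: "int \<Rightarrow> rat fps"
  assumes "s < 0 \<Longrightarrow> X = 0"
  shows "Q * Q ^ nat s * X = Q ^ nat (s + 1) * X"
proof (cases "s < 0")
  case False
  then have "nat (s + 1) = Suc (nat s)" by simp
  then show ?thesis by simp
qed (simp add: assms)

text \<open>This is the coefficient form of
  \<open>(1 - v)(1 - abq) g(a,b,v) = (1 + aq)(1 + bq) g(aq,bq,vq)\<close>. Terminal color
  \<open>u\<close> is eliminated by \<open>word_quot_u\<close>; eliminating terminal color
  \<open>b\<close> takes the equation for \<open>word_quot_a\<close> at both \<open>j\<close> and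
  \<open>j - 1\<close>.\<close>

lemma word_quot_functional_equation:
  defines "g \<equiv> word_quot Color_a"
  shows "(1 - Q ^ nat (i + j + t)) * g i j t =
    Q ^ nat (i + j + t) * (g (i-1) j t + g i (j-1) t + g (i-1) (j-1) t)
    + g i j (t-1) + Q * g (i-1) (j-1) t - Q * g (i-1) (j-1) (t-1)"
proof -
  let ?b = "word_quot Color_b"
  let ?s = "nat (i + j + t)" and ?s1 = "nat (i + j + t - 1)"
  have s1: "i + (j - 1) + t = i + j + t - 1" by simp
  have E: "(1 - Q ^ ?s) * g i j t = Q ^ ?s * g (i-1) j t + Q * ?b i (j-1) t + g i j (t-1)
     - Q * ?b i (j-1) (t-1)"
    using word_quot_a[of i j t] by (simp add: word_quot_u g_def)
  have E1: "(1 - Q ^ ?s1) * g i (j-1) t = Q ^ ?s1 * g (i-1) (j-1) t + Q * ?b i (j-2) t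
     + g i (j-1) (t-1) - Q * ?b i (j-2) (t-1)"
    using word_quot_a[of i "j-1" t] by (simp add: word_quot_u g_def s1)
  have sh: "Q * Q ^ ?s1 * g i' (j-1) t = Q ^ ?s * g i' (j-1) t" if "i' \<le> i" for i'
  proof -
    have "g i' (j-1) t = 0" if "i + j + t - 1 < 0"
      unfolding g_def using that \<open>i' \<le> i\<close> by (intro word_quot_neg) linarith
    then have "Q * Q ^ ?s1 * g i' (j-1) t = Q ^ nat (i + j + t - 1 + 1) * g i' (j-1) t"
      by (rule Q_pow_shift)
    then show ?thesis by simp
  qed
  \<comment> \<open>Expanding at \<open>j - 1\<close> leaves \<open>?b\<close> only at
    \<open>j - 2\<close>, in exactly the combination that \<open>E1\<close>, multiplied by
    \<open>Q\<close>, expresses through \<open>g\<close>.\<close>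
  have B: "Q * ?b i (j-1) t' = Q * g i (j-1) t' + Q * g (i-1) (j-1) t' - Q * (Q * ?b i (j-2) t')" for t'
    unfolding word_quot_b[of i "j-1" t'] by (simp add: g_def algebra_simps)
  have "Q * ((1 - Q ^ ?s1) * g i (j-1) t) = Q * g i (j-1) t - Q ^ ?s * g i (j-1) t"
    by (simp only: left_diff_distrib right_diff_distrib mult_1_left mult.assoc[symmetric] sh[OF order.refl])
  moreover have "Q * (Q ^ ?s1 * g (i-1) (j-1) t) = Q ^ ?s * g (i-1) (j-1) t"
    using sh[of "i-1"] by (simp add: algebra_simps)
  moreover note arg_cong[OF E1, of "\<lambda>x. Q * x"]
  ultimately have E2: "Q * g i (j-1) t - Q ^ ?s * g i (j-1) t = Q ^ ?s * g (i-1) (j-1) t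
     + Q * (Q * ?b i (j-2) t) + Q * g i (j-1) (t-1) - Q * (Q * ?b i (j-2) (t-1))"
    by (simp add: distrib_left right_diff_distrib)
  have C: "Q * (Q * ?b i (j-2) t) - Q * (Q * ?b i (j-2) (t-1)) = Q * g i (j-1) t
      - Q ^ ?s * g i (j-1) t - Q ^ ?s * g (i-1) (j-1) t - Q * g i (j-1) (t-1)"
    using E2 by (simp add: algebra_simps)
  have "(1 - Q ^ ?s) * g i j t = Q ^ ?s * g (i-1) j t + g i j (t-1)
      + (Q * g i (j-1) t + Q * g (i-1) (j-1) t) - (Q * g i (j-1) (t-1) + Q * g (i-1) (j-1) (t-1))
      - (Q * (Q * ?b i (j-2) t) - Q * (Q * ?b i (j-2) (t-1)))"
    unfolding E B by (simp add: algebra_simps)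
  then show ?thesis unfolding C by (simp add: algebra_simps)
qed

section \<open>Separation of the color \<open>u\<close>\<close>

definition base_gf :: "int \<Rightarrow> int \<Rightarrow> rat fps" where
  "base_gf i j = word_quot Color_a i j 0"

lemma base_gf_neg: "i < 0 \<or> j < 0 \<Longrightarrow> base_gf i j = 0"
  by (simp add: base_gf_def word_quot_neg)

lemma base_gf_0: "base_gf 0 0 = 1"
  by (simp add: base_gf_def word_quot_0)

lemma base_gf_rec: "(1 - Q ^ nat (i + j)) * base_gf i j =
    Q ^ nat (i + j) * (base_gf (i-1) j + base_gf i (j-1) + base_gf (i-1) (j-1))
    + Q * base_gf (i-1) (j-1)"
  using word_quot_functional_equation[of i j 0] by (simp add: base_gf_def word_quot_neg)

text \<open>The right side satisfies the functional equation of the left side. For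
  \<open>t \<ge> 1\<close> the factor \<open>1 - Q ^ nat (i + j + t)\<close> is nonzero, so the
  equation determines the value from smaller index sums.\<close>

lemma word_quot_factor:
  assumes "t \<ge> 0"
  shows "word_quot Color_a i j t = base_gf i j * iqfac (nat t)"
  using assms
proof (induction "nat (i + j + t)" arbitrary: i j t rule: less_induct)
  case less
  let ?s = "nat (i + j + t)"
  consider "i < 0 \<or> j < 0" | "t = 0" | "i \<ge> 0" "j \<ge> 0" "t \<ge> 1" using less.prems by linarith
  then show ?case
  proof cases
    case 1 then show ?thesis by (auto simp: base_gf_neg word_quot_neg)
  next
    case 2 then show ?thesis by (simp add: base_gf_def)
  next
    case 3
    let ?h = "iqfac (nat t)"
    have IH: "word_quot Color_a i' j' t' = base_gf i' j' * iqfac (nat t')"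
      if "i' \<le> i" "j' \<le> j" "t' \<le> t" "i' < i \<or> j' < j \<or> t' < t" "0 \<le> t'" for i' j' t'
    proof (rule less.hyps)
      show "nat (i' + j' + t') < nat (i + j + t)" using that 3 by linarith
    qed (use that in simp)
    have h: "iqfac (nat (t - 1)) = (1 - Q ^ nat t) * ?h"
    proof -
      have "nat t = Suc (nat (t - 1))" using 3 by simp
      then show ?thesis using iqfac_Suc[of "nat (t-1)"] by simp
    qed
    have pw: "Q ^ ?s = Q ^ nat t * Q ^ nat (i + j)"
      using 3 by (simp add: power_add[symmetric] nat_add_distrib[symmetric] add_ac)
    have "(1 - Q ^ ?s) * word_quot Color_a i j t =
      Q ^ ?s * (base_gf (i-1) j * ?h + base_gf i (j-1) * ?h + base_gf (i-1) (j-1) * ?h)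
      + base_gf i j * ((1 - Q ^ nat t) * ?h) + Q * (base_gf (i-1) (j-1) * ?h)
      - Q * (base_gf (i-1) (j-1) * ((1 - Q ^ nat t) * ?h))"
      unfolding word_quot_functional_equation h[symmetric] using 3 by (simp add: IH)
    also have "\<dots> = ?h * (Q ^ nat t * (Q ^ nat (i + j) * (base_gf (i-1) j + base_gf i (j-1) + base_gf (i-1) (j-1))
       + Q * base_gf (i-1) (j-1)) + (1 - Q ^ nat t) * base_gf i j)"
      unfolding pw by (simp add: algebra_simps)
    \<comment> \<open>Besides \<open>base_gf_rec\<close> this uses
      \<open>1 - Q^(t+i+j) = Q^t (1 - Q^(i+j)) + (1 - Q^t)\<close>.\<close>
    also have "\<dots> = (1 - Q ^ ?s) * (base_gf i j * ?h)"
      unfolding base_gf_rec[symmetric] pw by (simp add: algebra_simps)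
    finally show ?thesis using one_minus_Q_power_nz[of ?s] 3 by simp
  qed
qed

section \<open>Infinite products of formal power series\<close>

text \<open>
  A family of series in \<open>q\<close>, indexed by the exponents of \<open>a\<close> and \<open>b\<close>, read as one series in all three
  indeterminates; no convergence condition is needed.
\<close>

definition lift3 :: "(int \<Rightarrow> int \<Rightarrow> rat fps) \<Rightarrow> rat fps fps fps" where
  "lift3 f = Abs_fps (\<lambda>n. Abs_fps (\<lambda>j. Abs_fps (\<lambda>i. f (int i) (int j) $ n)))"

lemma lift3_nth [simp]: "lift3 f $ n $ j $ i = f (int i) (int j) $ n"
  by (simp add: lift3_def)

lemma fps3_eqI:
  fixes f g :: "'a fps fps fps"
  shows "(\<And>n j i. f $ n $ j $ i = g $ n $ j $ i) \<Longrightarrow> f = g"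
  by (intro fps_ext) auto

lemma lift3_cong:
  assumes "\<And>i j. i \<ge> 0 \<Longrightarrow> j \<ge> 0 \<Longrightarrow> f i j = g i j"
  shows "lift3 f = lift3 g"
  by (rule fps3_eqI) (simp add: assms)

lemma lift3_add: "lift3 f + lift3 g = lift3 (\<lambda>i j. f i j + g i j)"
  by (rule fps3_eqI) simp

lemma lift3_diff: "lift3 f - lift3 g = lift3 (\<lambda>i j. f i j - g i j)"
  by (rule fps3_eqI) simp

lemma ser_q_pow_mult_lift3: "ser_q ^ m * lift3 f = lift3 (\<lambda>i j. Q ^ m * f i j)"
  by (rule fps3_eqI) (simp add: ser_q_def fps_X_power_mult_nth)

text \<open>At exponent 0 of \<open>a\<close> the product has coefficient 0 while the shifted family
  is read at index -1; the hypothesis reconciles the two.\<close>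

lemma ser_a_mult_lift3:
  assumes "\<And>i j. i < 0 \<Longrightarrow> f i j = 0"
  shows "ser_a * lift3 f = lift3 (\<lambda>i j. f (i - 1) j)"
  by (rule fps3_eqI) (auto simp: ser_a_def assms of_nat_diff)

lemma ser_b_mult_lift3:
  assumes "\<And>i j. j < 0 \<Longrightarrow> f i j = 0"
  shows "ser_b * lift3 f = lift3 (\<lambda>i j. f i (j - 1))"
  by (rule fps3_eqI) (auto simp: ser_b_def assms of_nat_diff)

section \<open>Limits and infinite products in the q-adic topology\<close>

lemma tendsto_fps_mult:
  fixes f g :: "'b \<Rightarrow> 'a :: ring_1 fps"
  assumes "(f \<longlongrightarrow> a) F" "(g \<longlongrightarrow> b) F"
  shows "((\<lambda>x. f x * g x) \<longlongrightarrow> a * b) F"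
proof (rule tendsto_fpsI)
  fix n
  \<comment> \<open>Coefficient \<open>n\<close> of a product depends only on the coefficients up to
    \<open>n\<close> of the factors, finitely many eventually constant sequences.\<close>
  have "eventually (\<lambda>x. \<forall>k\<in>{..n}. f x $ k = a $ k) F" "eventually (\<lambda>x. \<forall>k\<in>{..n}. g x $ k = b $ k) F"
    using assms by (auto simp: tendsto_fps_iff eventually_ball_finite_distrib)
  then show "eventually (\<lambda>x. (f x * g x) $ n = (a * b) $ n) F"
    by eventually_elim (simp add: fps_mult_nth)
qed

text \<open>The order of \<open>x * q ^ k\<close> is at least \<open>k\<close>, so the partial
  products converge. All of them have constant coefficient 1, hence so does the limit, which is thus
  nonzero, as \<open>has_prod\<close> demands.\<close>

lemma qpoch_inf_fps:
  fixes x q :: "'a :: {idom, t2_space} fps"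
  assumes "x $ 0 = 0" "q $ 0 = 0" "x \<noteq> 0" "q \<noteq> 0"
  shows "(\<lambda>n. \<Prod>m<n. 1 - x * q ^ m) \<longlonglongrightarrow> qpoch_inf x q" "qpoch_inf x q $ 0 = 1"
proof -
  let ?f = "\<lambda>m. 1 - x * q ^ m"
  have f0: "?f m $ 0 = 1" for m
    using assms by simp
  then have nz: "?f m \<noteq> 0" for m
    by (metis fps_zero_nth zero_neq_one)
  have sd: "subdegree (?f k - 1) > n" if "k > n" for n k
  proof -
    have "subdegree (?f k - 1) = subdegree (x * q ^ k)"
      by simp
    also have "\<dots> = subdegree x + k * subdegree q"
      using assms by (simp add: subdegree_power)
    also have "\<dots> \<ge> k"
    proof -
      have "subdegree q \<ge> 1"
        using assms by (intro subdegree_geI) auto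
      then have "k * 1 \<le> k * subdegree q" by (rule mult_le_mono2)
      then show ?thesis by linarith
    qed
    finally show ?thesis using that by simp
  qed
  obtain P where P: "(\<lambda>n. \<Prod>k\<le>n. ?f k) \<longlonglongrightarrow> P"
    using tendsto_prod_fps[of ?f "\<lambda>n. n", OF nz sd] by blast
  have pr0: "(\<Prod>k\<in>A. ?f k) $ 0 = 1" for A :: "nat set"
    by (induction A rule: infinite_finite_induct) (simp_all add: f0 del: fps_sub_nth)
  obtain n where "(\<Prod>k\<le>n. ?f k) $ 0 = P $ 0"
    using P unfolding tendsto_fps_iff eventually_sequentially by blast
  then have P0: "P $ 0 = 1"
    using pr0 by simp
  then have "P \<noteq> 0" by auto
  with P have "?f has_prod P"
    by (simp add: has_prod_def raw_has_prod_def)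
  then have eq: "qpoch_inf x q = P"
    unfolding qpoch_inf_def by (rule has_prod_unique[symmetric])
  show "qpoch_inf x q $ 0 = 1" using eq P0 by simp
  show "(\<lambda>n. \<Prod>m<n. ?f m) \<longlonglongrightarrow> qpoch_inf x q"
    using P eq LIMSEQ_lessThan_iff_atMost[of "\<lambda>A. prod ?f A"] by simp
qed

text \<open>The coefficients lie in \<open>rat fps fps\<close>, which is not a field;
  \<open>y\<close> is invertible because its constant coefficient is 1.\<close>

lemma fps_divide_eqI:
  fixes x y z :: "rat fps fps fps"
  assumes "z * y = x" "y $ 0 = 1"
  shows "x / y = z"
proof -
  have inv: "inverse (1 :: rat fps fps) = 1"
    by (simp add: fps_inverse_one')
  have "y * inverse y = 1"
    unfolding fps_inverse_def[of y] by (rule fps_right_inverse) (simp only: inv assms(2) mult_1_left)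
  then have "z * y * inverse y = z" by (simp add: mult.assoc)
  then show ?thesis
    using assms by (subst fps_divide_unit) auto
qed

section \<open>Euler's expansion of the product (-q^(n+1);q)\<close>

definition euler_term :: "nat \<Rightarrow> nat \<Rightarrow> rat fps" where
  "euler_term n t = Q ^ (t * n + t * (t + 1) div 2) * iqfac t"

text \<open>Euler's series \<open>sum_t x^t q^(t(t-1)/2) / (q;q)_t\<close> at
  \<open>x = q^(n+1)\<close>. Cutting at \<open>t \<le> N\<close> loses nothing, since the term of
  index \<open>t\<close> has order at least \<open>t\<close>.\<close>

definition euler :: "nat \<Rightarrow> rat fps" where
  "euler n = Abs_fps (\<lambda>N. \<Sum>t\<le>N. euler_term n t $ N)"

lemma euler_term_nth_eq_0: "N < t \<Longrightarrow> euler_term n t $ N = 0"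
proof -
  assume "N < t"
  have "t \<le> t * (t + 1) div 2"
    by (cases t) auto
  then have "N < t * n + t * (t + 1) div 2" using \<open>N < t\<close> by linarith
  then show ?thesis by (simp add: euler_term_def fps_X_power_mult_nth)
qed

lemma euler_nth: "N \<le> M \<Longrightarrow> euler n $ N = (\<Sum>t\<le>M. euler_term n t $ N)"
  unfolding euler_def fps_nth_Abs_fps
  by (rule sum.mono_neutral_left) (auto simp: euler_term_nth_eq_0)

lemma mult_euler_nth: "(X * euler n) $ N = (\<Sum>t\<le>N. (X * euler_term n t) $ N)"
proof -
  have "(X * euler n) $ N = (\<Sum>k\<le>N. X $ k * (\<Sum>t\<le>N. euler_term n t $ (N - k)))"
    unfolding fps_mult_nth atLeast0AtMost
    by (rule sum.cong[OF refl], subst euler_nth[of _ N]) auto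
  also have "\<dots> = (\<Sum>t\<le>N. (X * euler_term n t) $ N)"
    unfolding fps_mult_nth atLeast0AtMost sum_distrib_left by (rule sum.swap)
  finally show ?thesis .
qed

text \<open>Split \<open>1 = Q ^ Suc t + (1 - Q ^ Suc t)\<close>; the second summand cancels the
  last factor of the q-factorial.\<close>

lemma euler_term_Suc_right:
  "euler_term n (Suc t) = euler_term (Suc n) (Suc t) + Q ^ Suc n * euler_term (Suc n) t"
proof -
  let ?e = "Suc t * n + Suc t * (Suc t + 1) div 2"
  have tri: "Suc t * (Suc t + 1) div 2 = Suc t + t * (t + 1) div 2"
    by (simp add: algebra_simps)
  have e1: "Suc t * Suc n + Suc t * (Suc t + 1) div 2 = ?e + Suc t"
    by (simp add: algebra_simps)
  have e2: "Suc n + (t * Suc n + t * (t + 1) div 2) = ?e"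
    unfolding tri by (simp add: algebra_simps)
  have "euler_term (Suc n) (Suc t) = Q ^ ?e * Q ^ Suc t * iqfac (Suc t)"
    unfolding euler_term_def e1 by (simp only: power_add)
  moreover have "Q ^ Suc n * euler_term (Suc n) t = Q ^ ?e * iqfac t"
    unfolding euler_term_def e2[symmetric] by (simp only: power_add mult.assoc)
  moreover have "iqfac t = iqfac (Suc t) - Q ^ Suc t * iqfac (Suc t)"
    using iqfac_Suc[of t] by (simp only: left_diff_distrib mult_1_left)
  ultimately show ?thesis
    unfolding euler_term_def[of n] by (simp only: right_diff_distrib mult.assoc) simp
qed

lemma euler_rec: "euler n = (1 + Q ^ Suc n) * euler (Suc n)"
proof (rule fps_ext)
  fix N
  have 0: "euler_term m 0 = 1" for m by (simp add: euler_term_def)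
  have "euler n $ N = (\<Sum>t\<le>Suc N. euler_term n t $ N)" by (rule euler_nth) simp
  also have "\<dots> = 1 $ N + (\<Sum>t\<le>N. euler_term (Suc n) (Suc t) $ N)
       + (\<Sum>t\<le>N. (Q ^ Suc n * euler_term (Suc n) t) $ N)"
    unfolding sum.atMost_Suc_shift 0 euler_term_Suc_right[of n] fps_add_nth sum.distrib
    by (simp only: add.assoc)
  also have "1 $ N + (\<Sum>t\<le>N. euler_term (Suc n) (Suc t) $ N) = (\<Sum>t\<le>Suc N. euler_term (Suc n) t $ N)"
    unfolding sum.atMost_Suc_shift 0 ..
  also have "\<dots> = euler (Suc n) $ N" by (rule euler_nth[symmetric]) simp
  also have "(\<Sum>t\<le>N. (Q ^ Suc n * euler_term (Suc n) t) $ N) = (Q ^ Suc n * euler (Suc n)) $ N"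
    by (rule mult_euler_nth[symmetric])
  finally show "euler n $ N = ((1 + Q ^ Suc n) * euler (Suc n)) $ N"
    by (simp only: distrib_right mult_1_left fps_add_nth)
qed

lemma euler_nth_0: "euler n $ 0 = 1"
  by (simp add: euler_def euler_term_def)

lemma euler_nth_small: "0 < N \<Longrightarrow> N \<le> n \<Longrightarrow> euler n $ N = 0"
  unfolding euler_def fps_nth_Abs_fps
proof (rule sum.neutral, rule ballI)
  fix t assume N: "0 < N" "N \<le> n"
  show "euler_term n t $ N = 0"
  proof (cases t)
    case 0 with N show ?thesis by (simp add: euler_term_def)
  next
    case (Suc t')
    have "Suc 0 \<le> t * (t + 1) div 2" using Suc by (cases t') auto
    moreover have "n \<le> t * n" using Suc by simp
    ultimately have "N < t * n + t * (t + 1) div 2" using N by linarith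
    then show ?thesis by (simp add: euler_term_def fps_X_power_mult_nth)
  qed
qed

text \<open>The finite product is the contribution of \<open>n\<close> optional overlines. Hence the
  sum over \<open>t\<close> will be \<open>euler 0\<close> for every
  \<open>n = i + j\<close>.\<close>

lemma euler_prod: "euler 0 = (\<Prod>l=1..n. 1 + Q ^ l) * euler n"
proof (induction n)
  case (Suc n)
  then show ?case by (subst (asm) euler_rec[of n]) (simp add: mult_ac)
qed simp

section \<open>The generating function as a quotient of infinite products\<close>

text \<open>
  With \<open>m\<close> factors removed from each infinite product, that is, with \<open>a q^m\<close>, \<open>b q^m\<close> in place of
  \<open>a\<close>, \<open>b\<close>: this avoids substitutions in formal power series.
\<close>

definition tail_gf :: "nat \<Rightarrow> rat fps fps fps" where
  "tail_gf m = lift3 (\<lambda>i j. Q ^ (m * nat (i + j)) * base_gf i j * euler m)"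

text \<open>Coefficientwise this is \<open>base_gf_rec\<close> multiplied by
  \<open>Q ^ (m * nat (i + j))\<close>; the factor \<open>1 + ser_q ^ Suc m\<close> comes from
  \<open>euler_rec\<close>.\<close>

lemma tail_gf_rec:
  "(1 - ser_a * ser_b * ser_q ^ (2 * m + 1)) * tail_gf m =
     (1 + ser_a * ser_q ^ Suc m) * (1 + ser_b * ser_q ^ Suc m) * (1 + ser_q ^ Suc m) * tail_gf (Suc m)"
proof -
  let ?n = "\<lambda>i j. nat (i + j)"
  define F where "F = (\<lambda>m i j. Q ^ (m * nat (i + j)) * base_gf i j)"
  have F_neg: "F m i j = 0" if "i < 0 \<or> j < 0" for m i j
    using that by (auto simp: F_def base_gf_neg)
  have T: "tail_gf k = lift3 (\<lambda>i j. F k i j * euler k)" for k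
    by (simp add: tail_gf_def F_def)
  have main: "F m i j - Q ^ (2 * m + 1) * F m (i-1) (j-1) =
     F (Suc m) i j + Q ^ Suc m * F (Suc m) (i-1) j + Q ^ Suc m * F (Suc m) i (j-1)
     + Q ^ (2 * Suc m) * F (Suc m) (i-1) (j-1)" if "i \<ge> 0" "j \<ge> 0" for i j
  proof -
    let ?n = "nat (i + j)"
    \<comment> \<open>Lowering one index lowers \<open>i + j\<close> by 1, which the factor
      \<open>Q ^ k\<close> makes up for; where \<open>nat\<close> would truncate,
      \<open>base_gf\<close> is 0.\<close>
    have sh1: "Q ^ k * F k i' j' = Q ^ (k * ?n) * base_gf i' j'"
      if "i' + j' + 1 = i + j" for k i' j'
    proof (cases "i' < 0 \<or> j' < 0")
      case True then show ?thesis by (auto simp: F_def base_gf_neg)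
    next
      case False
      then have "?n = Suc (nat (i' + j'))" using that by linarith
      then show ?thesis by (simp add: F_def power_add)
    qed
    have sh2: "Q ^ (2 * k) * F k (i-1) (j-1) = Q ^ (k * ?n) * base_gf (i-1) (j-1)" for k
    proof (cases "i - 1 < 0 \<or> j - 1 < 0")
      case True then show ?thesis by (auto simp: F_def base_gf_neg)
    next
      case False
      then have "?n = Suc (Suc (nat (i - 1 + (j - 1))))" by linarith
      then have "k * ?n = 2 * k + k * nat (i - 1 + (j - 1))" by simp
      then show ?thesis by (simp only: F_def power_add mult.assoc)
    qed
    have "Q ^ (2 * m + 1) * F m (i-1) (j-1) = Q ^ (m * ?n) * (Q * base_gf (i-1) (j-1))"
      using sh2[of m] by (simp add: mult_ac)
    then have "F m i j - Q ^ (2 * m + 1) * F m (i-1) (j-1) =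
        Q ^ (m * ?n) * (base_gf i j - Q * base_gf (i-1) (j-1))"
      by (simp only: F_def right_diff_distrib)
    also have "base_gf i j - Q * base_gf (i-1) (j-1) = Q ^ ?n * (base_gf i j +
       base_gf (i-1) j + base_gf i (j-1) + base_gf (i-1) (j-1))"
      using base_gf_rec[of i j] by (simp add: algebra_simps)
    also have "Q ^ (m * ?n) * \<dots> = Q ^ (Suc m * ?n) * (base_gf i j +
       base_gf (i-1) j + base_gf i (j-1) + base_gf (i-1) (j-1))"
      by (simp add: power_add mult_ac)
    finally show ?thesis
      unfolding sh2 by (subst sh1, simp)+ (simp only: F_def distrib_left)
  qed
  let ?a = ser_a and ?b = ser_b and ?q = ser_q
  have b_mult: "?b * lift3 (\<lambda>i j. F k i j * c) = lift3 (\<lambda>i j. F k i (j-1) * c)" for k c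
    by (subst ser_b_mult_lift3) (simp_all add: F_neg)
  have a_mult: "?a * lift3 (\<lambda>i j. F k i j * c) = lift3 (\<lambda>i j. F k (i-1) j * c)" for k c
    by (subst ser_a_mult_lift3) (simp_all add: F_neg)
  have ab_mult: "?a * lift3 (\<lambda>i j. F k i (j-1) * c) = lift3 (\<lambda>i j. F k (i-1) (j-1) * c)" for k c
    by (subst ser_a_mult_lift3) (simp_all add: F_neg)
  note ab_mult = ab_mult a_mult b_mult
  \<comment> \<open>The product is expanded so that \<open>?a\<close> and \<open>?b\<close> act
    directly on a lifted family, where they shift an index.\<close>
  have "(1 + ?a * ?q ^ Suc m) * (1 + ?b * ?q ^ Suc m) * (1 + ?q ^ Suc m) * tail_gf (Suc m) =
     (let T = (1 + ?q ^ Suc m) * tail_gf (Suc m) in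
        T + ?q ^ Suc m * (?a * T) + ?q ^ Suc m * (?b * T) + ?q ^ (2 * Suc m) * (?a * (?b * T)))"
  proof -
    have "?q ^ (2 * Suc m) = ?q ^ Suc m * ?q ^ Suc m"
      by (simp only: mult_2 power_add)
    then show ?thesis
      by (simp add: Let_def algebra_simps del: power_Suc)
  qed
  also have "(1 + ?q ^ Suc m) * tail_gf (Suc m) = lift3 (\<lambda>i j. F (Suc m) i j * euler m)" (is "_ = ?T")
    unfolding T euler_rec[of m]
    by (simp only: distrib_right mult_1_left ser_q_pow_mult_lift3 lift3_add)
      (simp add: algebra_simps)
  also have "(let T = ?T in
        T + ?q ^ Suc m * (?a * T) + ?q ^ Suc m * (?b * T) + ?q ^ (2 * Suc m) * (?a * (?b * T))) =
     lift3 (\<lambda>i j. (F (Suc m) i j + Q ^ Suc m * F (Suc m) (i-1) j + Q ^ Suc m * F (Suc m) i (j-1)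
     + Q ^ (2 * Suc m) * F (Suc m) (i-1) (j-1)) * euler m)"
    by (simp only: Let_def ab_mult ser_q_pow_mult_lift3 lift3_add distrib_right mult.assoc)
  also have "\<dots> = lift3 (\<lambda>i j. (F m i j - Q ^ (2 * m + 1) * F m (i-1) (j-1)) * euler m)"
    by (rule lift3_cong) (simp only: main)
  also have "\<dots> = tail_gf m - ?q ^ (2 * m + 1) * (?a * (?b * tail_gf m))"
    by (simp only: T ab_mult ser_q_pow_mult_lift3 lift3_diff left_diff_distrib mult.assoc)
  finally show ?thesis by (simp add: algebra_simps)
qed

text \<open>For \<open>m > N\<close> all coefficients with \<open>i + j > 0\<close> are divisible by
  \<open>Q ^ m\<close>, and \<open>euler m\<close> agrees with 1 up to order \<open>m\<close>, so
  only the constant 1 is left in degree \<open>N\<close>.\<close>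

lemma tail_gf_tendsto: "tail_gf \<longlonglongrightarrow> 1"
proof (rule tendsto_fpsI)
  fix N
  have "tail_gf m $ N = 1 $ N" if m: "N < m" for m
  proof (intro fps_ext)
    fix j i
    show "tail_gf m $ N $ j $ i = (1 :: rat fps fps fps) $ N $ j $ i"
    proof (cases "i = 0 \<and> j = 0")
      case True
      then show ?thesis using m
        by (cases "N = 0") (auto simp: tail_gf_def base_gf_0 euler_nth_0 euler_nth_small)
    next
      case False
      then have "m * 1 \<le> m * nat (int i + int j)" by (intro mult_le_mono2) auto
      then have "N < m * nat (int i + int j)" using m by linarith
      then have "(Q ^ (m * nat (int i + int j)) * (base_gf (int i) (int j) * euler m)) $ N = 0"
        by (simp only: fps_X_power_mult_nth if_True)
      then show ?thesis using False by (auto simp: tail_gf_def mult.assoc)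
    qed
  qed
  then show "eventually (\<lambda>m. tail_gf m $ N = 1 $ N) sequentially"
    by (rule eventually_mono[OF eventually_gt_at_top[of N]])
qed

lemma tail_gf_0:
  "tail_gf 0 = qpoch_inf (- ser_q) ser_q * qpoch_inf (- (ser_a * ser_q)) ser_q
             * qpoch_inf (- (ser_b * ser_q)) ser_q / qpoch_inf (ser_a * ser_b * ser_q) (ser_q ^ 2)"
proof -
  let ?P = "\<lambda>x q n. \<Prod>m<n. 1 - x * q ^ m"
  let ?a = ser_a and ?b = ser_b and ?q = ser_q
  have nz: "?q \<noteq> 0" "?q $ 0 = 0" "?a \<noteq> 0" "?b \<noteq> 0"
    by (auto simp: ser_q_def ser_a_def ser_b_def)
  have lims: "?P (- ?q) ?q \<longlonglongrightarrow> qpoch_inf (- ?q) ?q"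
    "?P (- (?a * ?q)) ?q \<longlonglongrightarrow> qpoch_inf (- (?a * ?q)) ?q"
    "?P (- (?b * ?q)) ?q \<longlonglongrightarrow> qpoch_inf (- (?b * ?q)) ?q"
    "?P (?a * ?b * ?q) (?q ^ 2) \<longlonglongrightarrow> qpoch_inf (?a * ?b * ?q) (?q ^ 2)"
    by (rule qpoch_inf_fps; simp add: nz power2_eq_square)+
  \<comment> \<open>The denominator stays on the left, so that only limits of products are needed;
    division comes after the limit.\<close>
  have fin: "tail_gf 0 * ?P (?a * ?b * ?q) (?q ^ 2) n =
     ?P (- ?q) ?q n * ?P (- (?a * ?q)) ?q n * ?P (- (?b * ?q)) ?q n * tail_gf n" for n
  proof (induction n)
    case (Suc n)
    have "tail_gf 0 * ?P (?a * ?b * ?q) (?q ^ 2) (Suc n) =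
      tail_gf 0 * ?P (?a * ?b * ?q) (?q ^ 2) n * (1 - ?a * ?b * ?q ^ (2 * n + 1))"
      by (simp add: power_mult[symmetric] mult_ac)
    also have "\<dots> = ?P (- ?q) ?q n * ?P (- (?a * ?q)) ?q n * ?P (- (?b * ?q)) ?q n *
        ((1 - ?a * ?b * ?q ^ (2 * n + 1)) * tail_gf n)"
      unfolding Suc by (simp only: mult_ac)
    also have "\<dots> = ?P (- ?q) ?q (Suc n) * ?P (- (?a * ?q)) ?q (Suc n) * ?P (- (?b * ?q)) ?q (Suc n)
        * tail_gf (Suc n)"
      unfolding tail_gf_rec by (simp add: mult_ac)
    finally show ?case .
  qed simp
  have "(\<lambda>n. tail_gf 0 * ?P (?a * ?b * ?q) (?q ^ 2) n) \<longlonglongrightarrow>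
      tail_gf 0 * qpoch_inf (?a * ?b * ?q) (?q ^ 2)"
    by (intro tendsto_fps_mult tendsto_const lims)
  moreover have "(\<lambda>n. tail_gf 0 * ?P (?a * ?b * ?q) (?q ^ 2) n) \<longlonglongrightarrow>
      qpoch_inf (- ?q) ?q * qpoch_inf (- (?a * ?q)) ?q * qpoch_inf (- (?b * ?q)) ?q * 1"
    unfolding fin by (intro tendsto_fps_mult lims tail_gf_tendsto)
  ultimately have "tail_gf 0 * qpoch_inf (?a * ?b * ?q) (?q ^ 2) =
      qpoch_inf (- ?q) ?q * qpoch_inf (- (?a * ?q)) ?q * qpoch_inf (- (?b * ?q)) ?q"
    using LIMSEQ_unique by fastforce
  moreover have "qpoch_inf (?a * ?b * ?q) (?q ^ 2) $ 0 = 1"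
    by (rule qpoch_inf_fps) (simp_all add: nz power2_eq_square)
  ultimately show ?thesis by (rule fps_divide_eqI[symmetric])
qed

section \<open>Counting jagged overpartitions\<close>

text \<open>Finiteness is demanded because \<open>card\<close> is 0 on infinite sets.\<close>

definition has_gf :: "('x \<Rightarrow> nat) \<Rightarrow> 'x set \<Rightarrow> rat fps \<Rightarrow> bool" where
  "has_gf w X F \<longleftrightarrow> (\<forall>N. finite {x \<in> X. w x = N} \<and> F $ N = of_nat (card {x \<in> X. w x = N}))"

lemma has_gf_bij:
  assumes "has_gf w' Y F" "bij_betw f X Y" "\<And>x. x \<in> X \<Longrightarrow> w' (f x) = w x"
  shows "has_gf w X F"
proof -
  have "bij_betw f {x \<in> X. w x = N} {y \<in> Y. w' y = N}" for N
    using assms(2,3) by (auto simp: bij_betw_def inj_on_def)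
  then show ?thesis
    using assms(1) unfolding has_gf_def by (metis bij_betw_finite bij_betw_same_card)
qed

lemma has_gf_prod:
  assumes "has_gf w X F" "has_gf w' Y G"
  shows "has_gf (\<lambda>(x, y). w x + w' y) (X \<times> Y) (F * G)"
  unfolding has_gf_def
proof (intro allI conjI)
  fix N
  let ?A = "\<lambda>k. {x \<in> X. w x = k} \<times> {y \<in> Y. w' y = N - k}"
  have eq: "{z \<in> X \<times> Y. (case z of (x, y) \<Rightarrow> w x + w' y) = N} = (\<Union>k\<in>{0..N}. ?A k)"
    by auto
  have fin: "finite (?A k)" for k
    using assms by (auto simp: has_gf_def)
  show "finite {z \<in> X \<times> Y. (case z of (x, y) \<Rightarrow> w x + w' y) = N}"
    unfolding eq using fin by blast
  have "card (\<Union>k\<in>{0..N}. ?A k) = (\<Sum>k=0..N. card (?A k))"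
    using fin by (intro card_UN_disjoint) auto
  then show "(F * G) $ N = of_nat (card {z \<in> X \<times> Y. (case z of (x, y) \<Rightarrow> w x + w' y) = N})"
    unfolding eq using assms by (simp add: fps_mult_nth has_gf_def card_cartesian_product)
qed

lemma has_gf_finite:
  assumes "finite X"
  shows "has_gf w X (\<Sum>x\<in>X. Q ^ w x)"
  unfolding has_gf_def
proof (intro allI conjI)
  fix N
  show "finite {x \<in> X. w x = N}" using assms by simp
  have "(\<Sum>x\<in>X. Q ^ w x) $ N = (\<Sum>x\<in>X. if w x = N then 1 else 0)"
    unfolding fps_sum_nth by (rule sum.cong) auto
  also have "\<dots> = (\<Sum>x\<in>{x \<in> X. w x = N}. 1)"
    by (rule sum.inter_filter[symmetric]) (rule assms)
  finally show "(\<Sum>x\<in>X. Q ^ w x) $ N = of_nat (card {x \<in> X. w x = N})" by simp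
qed

text \<open>Geometric series: a slack \<open>d\<close> after the part in position \<open>l\<close>
  raises \<open>l\<close> parts and so contributes \<open>l * d\<close>.\<close>

lemma has_gf_multiples:
  assumes "0 < l"
  shows "has_gf (\<lambda>d. l * d) UNIV (inverse (1 - Q ^ l))"
proof -
  define G :: "rat fps" where "G = Abs_fps (\<lambda>N. of_bool (l dvd N))"
  have "G * (1 - Q ^ l) = 1"
  proof (rule fps_ext)
    fix N
    have "(G * (1 - Q ^ l)) $ N = G $ N - (if N < l then 0 else G $ (N - l))"
      by (simp add: right_diff_distrib fps_X_power_mult_right_nth)
    also have "\<dots> = 1 $ N"
      using assms by (auto simp: G_def dvd_minus_self dest: dvd_imp_le)
    finally show "(G * (1 - Q ^ l)) $ N = 1 $ N" .
  qed
  then have "inverse (1 - Q ^ l) = G"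
    using assms by (intro fps_inverse_unique) (simp add: mult.commute)
  moreover have "{d. l * d = N} = (if l dvd N then {N div l} else {})" for N
    using assms by auto
  ultimately show ?thesis
    by (simp add: has_gf_def G_def)
qed

section \<open>Overlines and slacks\<close>

fun overline_weight :: "nat \<Rightarrow> (bool \<times> nat) list \<Rightarrow> nat" where
  "overline_weight k [] = 0"
| "overline_weight k ((r, d) # ys) = k * (of_bool r + d) + overline_weight (Suc k) ys"

lemma overline_weight_snoc:
  "overline_weight k (ys @ [(r, d)]) = overline_weight k ys + (k + length ys) * (of_bool r + d)"
  by (induction ys arbitrary: k) auto

text \<open>A pair holds the overline flag and the slack of a part. An overline raises the required
  difference by 1 and so weighs as much as a unit of slack. The first \<open>n\<close> flags are
  free, the later ones are forced.\<close>

definition overline_slacks :: "nat \<Rightarrow> nat \<Rightarrow> (bool \<times> nat) list set" where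
  "overline_slacks n s = {ys. length ys = s \<and> (\<forall>y\<in>set (drop n ys). fst y)}"

text \<open>The new last entry stands in position \<open>Suc s\<close>. Its flag contributes
  \<open>1 + Q ^ Suc s\<close> if free and \<open>Q ^ Suc s\<close> if forced, its slack a geometric
  series.\<close>

lemma has_gf_overline_slacks_Suc:
  assumes "has_gf (overline_weight 1) (overline_slacks n s) F"
  shows "has_gf (overline_weight 1) (overline_slacks n (Suc s))
     (F * ((of_bool (s < n) + Q ^ Suc s) * inverse (1 - Q ^ Suc s)))"
proof (rule has_gf_bij)
  let ?R = "{r. n \<le> s \<longrightarrow> r}"
  let ?w = "\<lambda>(r, d). Suc s * of_bool r + Suc s * d"
  have "has_gf (\<lambda>r. Suc s * of_bool r) ?R (\<Sum>r\<in>?R. Q ^ (Suc s * of_bool r))"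
    by (rule has_gf_finite) simp
  moreover have "?R = (if n \<le> s then {True} else {False, True})"
    by auto
  then have "(\<Sum>r\<in>?R. Q ^ (Suc s * of_bool r)) = of_bool (s < n) + Q ^ Suc s"
    by (simp del: power_Suc)
  ultimately have "has_gf ?w (?R \<times> UNIV) ((of_bool (s < n) + Q ^ Suc s) * inverse (1 - Q ^ Suc s))"
    using has_gf_prod[OF _ has_gf_multiples[of "Suc s"]] by fastforce
  from has_gf_prod[OF assms this]
  show "has_gf (\<lambda>(ys, y). overline_weight 1 ys + ?w y) (overline_slacks n s \<times> ?R \<times> UNIV)
     (F * ((of_bool (s < n) + Q ^ Suc s) * inverse (1 - Q ^ Suc s)))" .
  show "bij_betw (\<lambda>ys. (butlast ys, last ys)) (overline_slacks n (Suc s)) (overline_slacks n s \<times> ?R \<times> UNIV)"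
  proof (rule bij_betw_byWitness[where f' = "\<lambda>(ys, y). ys @ [y]"])
    show "\<forall>ys\<in>overline_slacks n (Suc s). (case (butlast ys, last ys) of (ys, y) \<Rightarrow> ys @ [y]) = ys"
      by (auto simp: overline_slacks_def intro!: append_butlast_last_id)
    show "\<forall>z\<in>overline_slacks n s \<times> ?R \<times> UNIV.
        (butlast (case z of (ys, y) \<Rightarrow> ys @ [y]), last (case z of (ys, y) \<Rightarrow> ys @ [y])) = z"
      by auto
    show "(\<lambda>ys. (butlast ys, last ys)) ` overline_slacks n (Suc s) \<subseteq> overline_slacks n s \<times> ?R \<times> UNIV"
    proof
      fix z assume "z \<in> (\<lambda>ys. (butlast ys, last ys)) ` overline_slacks n (Suc s)"
      then obtain ys where ys: "ys \<in> overline_slacks n (Suc s)" "z = (butlast ys, last ys)" by blast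
      then obtain zs r d where "ys = zs @ [(r, d)]"
        by (cases ys rule: rev_exhaust) (auto simp: overline_slacks_def)
      with ys show "z \<in> overline_slacks n s \<times> ?R \<times> UNIV" by (auto simp: overline_slacks_def)
    qed
    show "(\<lambda>(ys, y). ys @ [y]) ` (overline_slacks n s \<times> ?R \<times> UNIV) \<subseteq> overline_slacks n (Suc s)"
      by (auto simp: overline_slacks_def drop_Cons' split: if_splits)
  qed
  show "(case (butlast ys, last ys) of (ys, y) \<Rightarrow> overline_weight 1 ys + ?w y) = overline_weight 1 ys"
    if "ys \<in> overline_slacks n (Suc s)" for ys
  proof -
    from that obtain zs r d where "ys = zs @ [(r, d)]"
      by (cases ys rule: rev_exhaust) (auto simp: overline_slacks_def)
    with that show ?thesis by (simp add: overline_weight_snoc overline_slacks_def algebra_simps)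
  qed
qed

lemma iqfac_Suc': "iqfac (Suc n) = iqfac n * inverse (1 - Q ^ Suc n)"
  by (simp add: iqfac_def qfac_Suc fps_inverse_mult mult.commute)

lemma has_gf_overline_slacks_prefix:
  "s \<le> n \<Longrightarrow> has_gf (overline_weight 1) (overline_slacks n s) ((\<Prod>l=1..s. 1 + Q ^ l) * iqfac s)"
proof (induction s)
  case 0
  have "overline_slacks n 0 = {[]}" by (auto simp: overline_slacks_def)
  then show ?case using has_gf_finite[of "{[]}" "overline_weight 1"] by simp
next
  case (Suc s)
  then have "has_gf (overline_weight 1) (overline_slacks n s) ((\<Prod>l=1..s. 1 + Q ^ l) * iqfac s)" by simp
  from has_gf_overline_slacks_Suc[OF this] show ?case
    using Suc.prems by (simp add: iqfac_Suc' mult_ac del: power_Suc)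
qed

text \<open>The exponent is the sum of the positions \<open>n + 1, ..., n + t\<close> of the forced
  overlines.\<close>

lemma has_gf_overline_slacks:
  "has_gf (overline_weight 1) (overline_slacks n (n + t))
     ((\<Prod>l=1..n. 1 + Q ^ l) * Q ^ (t * n + t * (t + 1) div 2) * iqfac (n + t))"
proof (induction t)
  case 0
  show ?case using has_gf_overline_slacks_prefix[of n n] by simp
next
  case (Suc t)
  have e: "Suc t * n + Suc t * (Suc t + 1) div 2 = (t * n + t * (t + 1) div 2) + Suc (n + t)"
    by (simp add: algebra_simps)
  show ?case
    using has_gf_overline_slacks_Suc[OF Suc] unfolding e power_add[of Q _ "Suc (n + t)"]
    by (simp add: iqfac_Suc' mult_ac del: power_Suc)
qed

definition slack_weight :: "(color \<times> bool \<times> nat) list \<Rightarrow> nat" where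
  "slack_weight ys = word_weight 1 Color_a (map fst ys) + overline_weight 1 (map snd ys)"

definition slacks :: "nat \<Rightarrow> nat \<Rightarrow> nat \<Rightarrow> (color \<times> bool \<times> nat) list set" where
  "slacks i j t = {ys. map fst ys \<in> words (int i) (int j) (int t) \<and>
     (\<forall>y\<in>set (drop (i + j) ys). fst (snd y))}"

text \<open>Colors are chosen independently of flags and slacks, so the generating functions
  multiply. The factor \<open>iqfac (i + j + t)\<close> of the slacks turns \<open>word_gf\<close>
  into \<open>word_quot\<close>, to which \<open>word_quot_factor\<close> applies.\<close>

lemma has_gf_slacks:
  "has_gf slack_weight (slacks i j t)
     (base_gf (int i) (int j) * (\<Prod>l=1..i+j. 1 + Q ^ l) *
        (Q ^ (t * (i + j) + t * (t + 1) div 2) * iqfac t))"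
proof (rule has_gf_bij)
  let ?W = "words (int i) (int j) (int t)" and ?O = "overline_slacks (i + j) (i + j + t)"
  have "has_gf (word_weight 1 Color_a) ?W (word_gf Color_a (int i) (int j) (int t))"
    unfolding word_gf_def by (rule has_gf_finite) (rule finite_words)
  from has_gf_prod[OF this has_gf_overline_slacks]
  have "has_gf (\<lambda>(w, ys). word_weight 1 Color_a w + overline_weight 1 ys) (?W \<times> ?O)
     (word_gf Color_a (int i) (int j) (int t) * ((\<Prod>l=1..i+j. 1 + Q ^ l) *
       Q ^ (t * (i + j) + t * (t + 1) div 2) * iqfac (i + j + t)))" .
  moreover have "word_gf Color_a (int i) (int j) (int t) * iqfac (i + j + t) =
      base_gf (int i) (int j) * iqfac t"
    using word_quot_factor[of "int t" "int i" "int j"]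
    by (simp add: word_quot_def nat_add_distrib)
  then have "word_gf Color_a (int i) (int j) (int t) * (P * R * iqfac (i + j + t)) =
     base_gf (int i) (int j) * P * (R * iqfac t)" for P R
  proof -
    assume eq: "word_gf Color_a (int i) (int j) (int t) * iqfac (i + j + t) =
      base_gf (int i) (int j) * iqfac t"
    have "word_gf Color_a (int i) (int j) (int t) * (P * R * iqfac (i + j + t)) =
      word_gf Color_a (int i) (int j) (int t) * iqfac (i + j + t) * (P * R)"
      by (simp only: mult_ac)
    then show ?thesis unfolding eq by (simp only: mult_ac)
  qed
  ultimately show "has_gf (\<lambda>(w, ys). word_weight 1 Color_a w + overline_weight 1 ys) (?W \<times> ?O)
     (base_gf (int i) (int j) * (\<Prod>l=1..i+j. 1 + Q ^ l) *
        (Q ^ (t * (i + j) + t * (t + 1) div 2) * iqfac t))"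
    by simp
  have len: "length w = i + j + t" if "w \<in> ?W" for w
    using words_length[OF that] by linarith
  show "bij_betw (\<lambda>ys. (map fst ys, map snd ys)) (slacks i j t) (?W \<times> ?O)"
  proof (rule bij_betw_byWitness[where f' = "\<lambda>(w, ys). zip w ys"])
    show "\<forall>ys\<in>slacks i j t. (case (map fst ys, map snd ys) of (w, ys) \<Rightarrow> zip w ys) = ys"
      by (simp add: zip_map_fst_snd)
    show "\<forall>z\<in>?W \<times> ?O. (map fst (case z of (w, ys) \<Rightarrow> zip w ys),
        map snd (case z of (w, ys) \<Rightarrow> zip w ys)) = z"
      using len by (auto simp: overline_slacks_def)
    show "(\<lambda>ys. (map fst ys, map snd ys)) ` slacks i j t \<subseteq> ?W \<times> ?O"
      using len by (force simp: slacks_def overline_slacks_def drop_map)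
    show "(\<lambda>(w, ys). zip w ys) ` (?W \<times> ?O) \<subseteq> slacks i j t"
      using len by (auto simp: slacks_def overline_slacks_def drop_zip dest!: set_zip_rightD)
  qed
qed (simp add: slack_weight_def)

section \<open>Sequences described by their slacks\<close>

definition excess :: "part list \<Rightarrow> nat" where
  "excess xs = (case xs of [] \<Rightarrow> 0 | x # _ \<Rightarrow> part_size x - of_bool (part_color x = Color_b))"

text \<open>\<open>excess\<close> is the first part after the shift of color \<open>b\<close>. For
  the empty list it is 0 and the next color is \<open>Color_a\<close>: the fictitious part 0 of
  color \<open>a\<close> behind the last part.\<close>

definition least_size :: "color \<Rightarrow> bool \<Rightarrow> part list \<Rightarrow> nat" where
  "least_size c r xs = of_bool (c = Color_b) + color_gap c (first_color (map part_color xs) Color_a)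
     + of_bool r + excess xs"

fun admissible :: "part list \<Rightarrow> bool" where
  "admissible [] \<longleftrightarrow> True"
| "admissible (x # xs) \<longleftrightarrow> least_size (part_color x) (overlined x) xs \<le> part_size x \<and> admissible xs"

text \<open>
  Recording how far each difference exceeds its lower bound turns jagged overpartitions into
  arbitrary lists.
\<close>

fun build :: "(color \<times> bool \<times> nat) list \<Rightarrow> part list" where
  "build [] = []"
| "build ((c, r, d) # ys) = Part (least_size c r (build ys) + d) c r # build ys"

fun slack :: "part list \<Rightarrow> (color \<times> bool \<times> nat) list" where
  "slack [] = []"
| "slack (x # xs) = (part_color x, overlined x,
     part_size x - least_size (part_color x) (overlined x) xs) # slack xs"

lemma admissible_build: "admissible (build ys)"
  by (induction ys rule: build.induct) auto

lemma slack_build: "slack (build ys) = ys"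
  by (induction ys rule: build.induct) auto

lemma build_slack: "admissible xs \<Longrightarrow> build (slack xs) = xs"
  by (induction xs) auto

lemma map_fst_slack: "map fst (slack xs) = map part_color xs"
  by (induction xs) auto

lemma map_overlined_slack: "map (\<lambda>y. fst (snd y)) (slack xs) = map overlined xs"
  by (induction xs) auto

text \<open>The gaps, overlines and slacks of \<open>xs\<close> add up to \<open>excess xs\<close>,
  and they raise each of \<open>k\<close> further parts in front by that amount. The induction needs
  general \<open>k\<close>.\<close>

lemma sum_part_sizes_eq:
  "admissible xs \<Longrightarrow> word_weight (Suc k) Color_a (map fst (slack xs)) + overline_weight (Suc k) (map snd (slack xs))
     = sum_list (map part_size xs) + k * excess xs"
proof (induction xs arbitrary: k)
  case (Cons x xs)
  then have IH: "word_weight (Suc (Suc k)) Color_a (map part_color xs) +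
      overline_weight (Suc (Suc k)) (map snd (slack xs)) = sum_list (map part_size xs) + Suc k * excess xs"
    by (simp add: map_fst_slack)
  define d where "d = part_size x - least_size (part_color x) (overlined x) xs"
  have sz: "part_size x = least_size (part_color x) (overlined x) xs + d"
    using Cons.prems by (simp add: d_def)
  have ex: "excess (x # xs) = color_gap (part_color x) (first_color (map part_color xs) Color_a)
     + of_bool (overlined x) + excess xs + d"
    by (simp add: excess_def sz least_size_def)
  have "sum_list (map part_size (x # xs)) + k * excess (x # xs) =
     of_bool (part_color x = Color_b) + Suc k * (color_gap (part_color x) (first_color (map part_color xs) Color_a)
     + of_bool (overlined x) + d) + (sum_list (map part_size xs) + Suc k * excess xs)"
    unfolding ex by (simp add: sz least_size_def algebra_simps)
  then show ?case
    unfolding IH[symmetric] by (simp add: map_fst_slack d_def[symmetric] algebra_simps)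
qed (simp add: excess_def)

lemma slack_weight_slack: "admissible xs \<Longrightarrow> slack_weight (slack xs) = sum_list (map part_size xs)"
  using sum_part_sizes_eq[of xs 0] by (simp add: slack_weight_def)

lemma count_list_num_color: "count_list (map part_color xs) c = num_color c xs"
  by (induction xs) (auto simp: num_color_def)

lemma words_map_part_color:
  "map part_color xs \<in> words (int i) (int j) (int t) \<longleftrightarrow>
     num_color Color_a xs = i \<and> num_color Color_b xs = j \<and> num_color Color_u xs = t"
  by (simp add: words_def count_list_num_color)

definition admissible_set :: "nat \<Rightarrow> nat \<Rightarrow> nat \<Rightarrow> part list set" where
  "admissible_set i j t = {xs. admissible xs \<and> num_color Color_a xs = i \<and> num_color Color_b xs = j \<and>
     num_color Color_u xs = t \<and> final_overlined t xs}"

lemma final_overlined_slack: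
  assumes "num_color Color_a xs = i" "num_color Color_b xs = j" "num_color Color_u xs = t"
  shows "final_overlined t xs \<longleftrightarrow> (\<forall>y\<in>set (drop (i + j) (slack xs)). fst (snd y))"
proof -
  have "length xs = i + j + t"
    using length_eq_sum_counts[of "map part_color xs"] assms by (simp add: count_list_num_color)
  then have "final_overlined t xs \<longleftrightarrow> (\<forall>r\<in>set (drop (i + j) (map overlined xs)). r)"
    by (simp add: final_overlined_def drop_map)
  then show ?thesis
    unfolding map_overlined_slack[symmetric] by (simp add: drop_map)
qed

lemma slack_in_slacks:
  "admissible xs \<Longrightarrow> slack xs \<in> slacks i j t \<longleftrightarrow> xs \<in> admissible_set i j t"
  unfolding slacks_def admissible_set_def mem_Collect_eq map_fst_slack words_map_part_color
  by (rule iffI; elim conjE; simp only: final_overlined_slack simp_thms)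

lemma has_gf_admissible_set:
  "has_gf (\<lambda>xs. sum_list (map part_size xs)) (admissible_set i j t)
     (base_gf (int i) (int j) * (\<Prod>l=1..i+j. 1 + Q ^ l) *
        (Q ^ (t * (i + j) + t * (t + 1) div 2) * iqfac t))"
proof (rule has_gf_bij[OF has_gf_slacks])
  show "bij_betw slack (admissible_set i j t) (slacks i j t)"
  proof (rule bij_betw_byWitness[where f' = build])
    show "slack ` admissible_set i j t \<subseteq> slacks i j t"
      using slack_in_slacks by (auto simp: admissible_set_def)
    show "build ` slacks i j t \<subseteq> admissible_set i j t"
      using slack_in_slacks[OF admissible_build] by (auto simp: slack_build)
  qed (auto simp: admissible_set_def build_slack slack_build)
  show "slack_weight (slack xs) = sum_list (map part_size xs)" if "xs \<in> admissible_set i j t" for xs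
    using that by (simp add: admissible_set_def slack_weight_slack)
qed

section \<open>Jaggedness compared with admissibility\<close>

lemma excess_Cons: "excess (x # xs) = part_size x - of_bool (part_color x = Color_b)"
  by (simp add: excess_def)

text \<open>Shifted parts weakly decrease, so the first one bounds all others.\<close>

lemma excess_mono:
  assumes "admissible xs" "y \<in> set xs"
  shows "part_size y \<le> excess xs + of_bool (part_color y = Color_b)"
  using assms
proof (induction xs)
  case (Cons x xs)
  have "excess xs \<le> excess (x # xs)"
    using Cons.prems(1) by (auto simp: excess_Cons least_size_def)
  then show ?case
    using Cons by (cases "y = x") (force simp: excess_Cons)+
qed simp

text \<open>Freed of the fixed sum, the notion passes to tails of lists.\<close>

definition jagged :: "part list \<Rightarrow> bool" where
  "jagged xs \<longleftrightarrow> jagged_overpartition (sum_list (map part_size xs)) xs"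

lemma jagged_Nil: "jagged []"
  by (simp add: jagged_def jagged_overpartition_def)

lemma jagged_Cons:
  "jagged (x # xs) \<longleftrightarrow>
     (overlined x \<longrightarrow> part_size x > 0 \<and>
        (\<forall>y\<in>set xs. \<not> (part_size y = part_size x \<and> part_color y = part_color x))) \<and>
     (xs = [] \<longrightarrow> x \<notin> {Part 0 Color_a False, Part 0 Color_b False, Part 1 Color_a True, Part 1 Color_b True}) \<and>
     (xs \<noteq> [] \<longrightarrow> int (part_size x) - int (part_size (hd xs)) \<ge> min_diff x (hd xs)) \<and> jagged xs"
proof -
  define Ov where "Ov = (\<lambda>ys l. overlined (ys ! l) \<longrightarrow> part_size (ys ! l) > 0 \<and>
        (\<forall>m. l < m \<and> m < length ys \<longrightarrow>
           \<not> (part_size (ys ! m) = part_size (ys ! l) \<and> part_color (ys ! m) = part_color (ys ! l))))"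
  define D where "D = (\<lambda>ys l.
        int (part_size (ys ! l)) - int (part_size (ys ! Suc l)) \<ge> min_diff (ys ! l) (ys ! Suc l))"
  have jagged_eq: "jagged ys \<longleftrightarrow> (\<forall>l<length ys. Ov ys l) \<and>
     (ys \<noteq> [] \<longrightarrow> last ys \<notin>
        {Part 0 Color_a False, Part 0 Color_b False, Part 1 Color_a True, Part 1 Color_b True}) \<and>
     (\<forall>l. Suc l < length ys \<longrightarrow> D ys l)" for ys
    unfolding jagged_def jagged_overpartition_def Ov_def D_def by simp
  have Ov_Suc: "Ov (x # xs) (Suc l) \<longleftrightarrow> Ov xs l" for l
  proof -
    have "(\<forall>m. Suc l < m \<and> m < Suc (length xs) \<longrightarrow> P m) \<longleftrightarrow>
        (\<forall>m. l < m \<and> m < length xs \<longrightarrow> P (Suc m))" for P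
      by (metis Suc_less_eq Suc_lessE)
    then show ?thesis by (simp add: Ov_def del: imp_conjL)
  qed
  have "(\<forall>m. 0 < m \<and> m < Suc (length xs) \<longrightarrow> P m) \<longleftrightarrow> (\<forall>m<length xs. P (Suc m))" for P
    by (metis Suc_less_eq gr0_implies_Suc zero_less_Suc)
  then have Ov_0: "Ov (x # xs) 0 \<longleftrightarrow> (overlined x \<longrightarrow> part_size x > 0 \<and>
        (\<forall>y\<in>set xs. \<not> (part_size y = part_size x \<and> part_color y = part_color x)))"
    by (simp add: Ov_def all_set_conv_all_nth del: imp_conjL)
  have D: "(\<forall>l. Suc l < length (x # xs) \<longrightarrow> D (x # xs) l) \<longleftrightarrow>
      (xs \<noteq> [] \<longrightarrow> int (part_size x) - int (part_size (hd xs)) \<ge> min_diff x (hd xs)) \<and>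
      (\<forall>l. Suc l < length xs \<longrightarrow> D xs l)"
    by (cases xs) (simp_all add: D_def All_less_Suc2)
  have "(\<forall>l<length (x # xs). Ov (x # xs) l) \<longleftrightarrow> Ov (x # xs) 0 \<and> (\<forall>l<length xs. Ov xs l)"
    by (simp add: All_less_Suc2 Ov_Suc)
  then show ?thesis
    unfolding jagged_eq[of "x # xs"] D Ov_0 jagged_eq[of xs] by (cases xs) auto
qed

text \<open>All 36 entries follow one formula; it does not involve the overline of \<open>y\<close>,
  since the first three columns of the matrix repeat as the last three.\<close>

lemma min_diff_eq:
  "min_diff x y = int (of_bool (part_color x = Color_b)) - int (of_bool (part_color y = Color_b))
     + int (color_gap (part_color x) (part_color y)) + int (of_bool (overlined x))"
proof -
  obtain u c r v e s where "x = Part u c r" "y = Part v e s"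
    by (metis part.exhaust)
  then show ?thesis
    by (cases c; cases e; cases r; cases s; simp add: min_diff_def diff_matrix_def)
qed

lemma jagged_iff_admissible: "jagged xs \<longleftrightarrow> admissible xs"
proof (induction xs)
  case Nil
  show ?case by (simp add: jagged_Nil)
next
  case (Cons x xs)
  \<comment> \<open>The four excluded last parts, together with positivity of overlined parts, are
    exactly what the fictitious final part 0 of color \<open>a\<close> excludes.\<close>
  have last: "(overlined x \<longrightarrow> part_size x > 0) \<and>
      x \<notin> {Part 0 Color_a False, Part 0 Color_b False, Part 1 Color_a True, Part 1 Color_b True}
      \<longleftrightarrow> least_size (part_color x) (overlined x) [] \<le> part_size x"
    by (cases x; cases "part_color x"; cases "overlined x")
      (auto simp: least_size_def excess_def first_color_def)
  have step: "int (part_size x) - int (part_size (hd xs)) \<ge> min_diff x (hd xs)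
      \<longleftrightarrow> least_size (part_color x) (overlined x) xs \<le> part_size x" if "admissible xs" "xs \<noteq> []"
  proof -
    from that obtain y ys where xs: "xs = y # ys" by (cases xs) auto
    \<comment> \<open>A part of color \<open>b\<close> is positive here, so the truncated
      subtraction in \<open>excess\<close> is exact.\<close>
    with that have "of_bool (part_color y = Color_b) \<le> part_size y"
      by (auto simp: least_size_def)
    then show ?thesis
      unfolding min_diff_eq by (auto simp: xs least_size_def excess_def first_color_def)
  qed
  \<comment> \<open>An overlined part exceeds, after the shift, every later part, so no equal part
    of its color can follow.\<close>
  have over: "overlined x \<longrightarrow> part_size x > 0 \<and>
        (\<forall>y\<in>set xs. \<not> (part_size y = part_size x \<and> part_color y = part_color x))"
    if "least_size (part_color x) (overlined x) xs \<le> part_size x" "admissible xs"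
  proof (intro impI conjI ballI notI)
    assume o: "overlined x"
    with that(1) show "part_size x > 0" by (simp add: least_size_def)
    fix y assume y: "y \<in> set xs" "part_size y = part_size x \<and> part_color y = part_color x"
    then show False
      using excess_mono[OF that(2) y(1)] that(1) o by (simp add: least_size_def)
  qed
  show ?case
  proof (cases "xs = []")
    case True
    show ?thesis using last unfolding jagged_Cons True by (auto simp: jagged_Nil)
  next
    case False
    then show ?thesis using step over unfolding jagged_Cons Cons.IH admissible.simps by blast
  qed
qed

section \<open>Summation over \<open>t\<close> and finiteness for a given size\<close>

lemma C3_set_eq:
  "C3_set n k i j = {xs. (\<exists>t. xs \<in> admissible_set i j t) \<and> sum_list (map part_size xs) = n \<and> num_non_overlined xs = k}"
proof -
  have "jagged_overpartition n xs \<longleftrightarrow> sum_list (map part_size xs) = n \<and> admissible xs" for xs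
    unfolding jagged_iff_admissible[symmetric] jagged_def by (auto simp: jagged_overpartition_def)
  then show ?thesis by (auto simp: C3_set_def admissible_set_def)
qed

text \<open>A letter \<open>a\<close> either precedes a \<open>b\<close>, with which it is matched,
  or has a gap of weight at least 1. The \<open>of_bool\<close> terms keep track of a
  \<open>b\<close> at the start of \<open>w\<close> and in the terminal color.\<close>

lemma count_a_le:
  "0 < k \<Longrightarrow> count_list w Color_a + of_bool (first_color w e = Color_b)
     \<le> word_weight k e w + count_list w Color_b + of_bool (e = Color_b)"
proof (induction w arbitrary: k)
  case (Cons c w)
  from Cons.IH[of "Suc k"] Cons.prems show ?case
    by (cases c) (auto simp: first_color_def split: if_splits)
qed (simp add: first_color_def)

lemma count_b_le: "count_list w Color_b \<le> word_weight k e w"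
proof (induction w arbitrary: k)
  case (Cons c w)
  from Cons.IH[of "Suc k"] show ?case by (cases c) auto
qed simp

definition admissible_ab :: "nat \<Rightarrow> nat \<Rightarrow> part list set" where
  "admissible_ab i j = (\<Union>t. admissible_set i j t)"

lemma has_gf_admissible_ab:
  "has_gf (\<lambda>xs. sum_list (map part_size xs)) (admissible_ab i j) (base_gf (int i) (int j) * euler 0)"
  unfolding has_gf_def
proof (intro allI conjI)
  fix N
  define X where "X = base_gf (int i) (int j) * (\<Prod>l=1..i+j. 1 + Q ^ l)"
  define S where "S = (\<lambda>t. {xs \<in> admissible_set i j t. sum_list (map part_size xs) = N})"
  have fin: "finite (S t)" and card: "of_nat (card (S t)) = (X * euler_term (i + j) t) $ N" for t
    using has_gf_admissible_set[of i j t] by (simp_all add: has_gf_def S_def X_def euler_term_def)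
  \<comment> \<open>The vanishing coefficient is the cardinality of the finite set
    \<open>S t\<close>, so the generating function itself bounds \<open>t\<close>.\<close>
  have empty: "S t = {}" if "N < t" for t
  proof -
    have "(X * euler_term (i + j) t) $ N = 0"
      using that by (simp add: fps_mult_nth euler_term_nth_eq_0)
    then show ?thesis using card[of t] fin[of t] by simp
  qed
  have eq: "{xs \<in> admissible_ab i j. sum_list (map part_size xs) = N} = (\<Union>t\<in>{..N}. S t)"
  proof (intro set_eqI iffI)
    fix xs assume "xs \<in> {xs \<in> admissible_ab i j. sum_list (map part_size xs) = N}"
    then obtain t where t: "xs \<in> S t" by (auto simp: admissible_ab_def S_def)
    then have "t \<le> N" using empty[of t] by (cases "t \<le> N") auto
    with t show "xs \<in> (\<Union>t\<in>{..N}. S t)" by blast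
  qed (auto simp: admissible_ab_def S_def)
  show "finite {xs \<in> admissible_ab i j. sum_list (map part_size xs) = N}"
    unfolding eq using fin by blast
  have "base_gf (int i) (int j) * euler 0 = X * euler (i + j)"
    by (simp add: X_def euler_prod[of "i + j"] mult.assoc)
  then have "(base_gf (int i) (int j) * euler 0) $ N = (\<Sum>t\<le>N. of_nat (card (S t)))"
    by (simp only: mult_euler_nth card)
  also have "\<dots> = of_nat (card (\<Union>t\<in>{..N}. S t))"
    using fin by (subst card_UN_disjoint) (auto simp: S_def admissible_set_def)
  finally show "(base_gf (int i) (int j) * euler 0) $ N =
      of_nat (card {xs \<in> admissible_ab i j. sum_list (map part_size xs) = N})"
    unfolding eq .
qed

text \<open>Leaves finitely many pairs \<open>(i, j)\<close> for each size, as summability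
  requires.\<close>

lemma num_color_le:
  assumes "admissible xs"
  shows "num_color Color_b xs \<le> sum_list (map part_size xs)"
    and "num_color Color_a xs \<le> 2 * sum_list (map part_size xs)"
proof -
  let ?w = "map part_color xs"
  have w: "word_weight 1 Color_a ?w \<le> sum_list (map part_size xs)"
    using slack_weight_slack[OF assms] by (simp add: slack_weight_def map_fst_slack)
  then show b: "num_color Color_b xs \<le> sum_list (map part_size xs)"
    using count_b_le[of ?w 1 Color_a] by (simp add: count_list_num_color)
  show "num_color Color_a xs \<le> 2 * sum_list (map part_size xs)"
    using count_a_le[of 1 ?w Color_a] w b by (simp add: count_list_num_color)
qed

definition admissible_of_size :: "nat \<Rightarrow> part list set" where
  "admissible_of_size N = {xs. (\<exists>i j. xs \<in> admissible_ab i j) \<and> sum_list (map part_size xs) = N}"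

lemma admissible_of_size_eq:
  "{xs \<in> admissible_of_size N. num_color Color_a xs = i \<and> num_color Color_b xs = j} =
     {xs \<in> admissible_ab i j. sum_list (map part_size xs) = N}"
  by (auto simp: admissible_of_size_def admissible_ab_def admissible_set_def)

lemma finite_admissible_of_size: "finite (admissible_of_size N)"
proof (rule finite_subset)
  show "admissible_of_size N \<subseteq> (\<Union>i\<in>{..2 * N}. \<Union>j\<in>{..N}. {xs \<in> admissible_ab i j. sum_list (map part_size xs) = N})"
  proof
    fix xs assume "xs \<in> admissible_of_size N"
    then obtain i j t where xs: "xs \<in> admissible_set i j t" "sum_list (map part_size xs) = N"
      by (auto simp: admissible_of_size_def admissible_ab_def)
    with num_color_le[of xs] have "i \<le> 2 * N" "j \<le> N" by (auto simp: admissible_set_def)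
    with xs show "xs \<in> (\<Union>i\<in>{..2 * N}. \<Union>j\<in>{..N}. {xs \<in> admissible_ab i j. sum_list (map part_size xs) = N})"
      by (auto simp: admissible_ab_def)
  qed
qed (use has_gf_admissible_ab in \<open>simp add: has_gf_def\<close>)

section \<open>The sum over all statistics\<close>

definition stats :: "part list \<Rightarrow> nat \<times> nat \<times> nat \<times> nat" where
  "stats xs = (sum_list (map part_size xs), num_non_overlined xs, num_color Color_a xs, num_color Color_b xs)"

lemma C3_eq: "C3 n k i j = card {xs \<in> admissible_of_size n. stats xs = (n, k, i, j)}"
  unfolding C3_def C3_set_eq
  by (rule arg_cong[of _ _ card]) (auto simp: admissible_of_size_def admissible_ab_def admissible_set_def stats_def)

lemma monomial_nth:
  "(ser_a ^ i * ser_b ^ j * ser_q ^ n) $ N $ j' $ i' = of_bool (N = n \<and> j' = j \<and> i' = i)"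
  by (auto simp: ser_a_def ser_b_def ser_q_def fps_const_power fps_X_power_mult_right_nth
      fps_mult_left_const_nth simp flip: mult.assoc)

lemma of_nat_mult_nth: "(of_nat c * F) $ n = of_nat c * F $ n"
  by (metis fps_mult_left_const_nth fps_of_nat)

text \<open>The coefficient of \<open>q^N\<close> is a finite sum with one monomial in
  \<open>a\<close> and \<open>b\<close> for each admissible sequence counted.\<close>

lemma tail_gf_0_nth:
  "tail_gf 0 $ N = (\<Sum>xs\<in>admissible_of_size N.
     (ser_a ^ num_color Color_a xs * ser_b ^ num_color Color_b xs * ser_q ^ N) $ N)"
proof (intro fps_ext)
  fix j i
  have "tail_gf 0 $ N $ j $ i = of_nat (card {xs \<in> admissible_ab i j. sum_list (map part_size xs) = N})"
    using has_gf_admissible_ab[of i j] by (simp add: tail_gf_def has_gf_def)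
  also have "\<dots> = of_nat (card {xs \<in> admissible_of_size N. j = num_color Color_b xs \<and> i = num_color Color_a xs})"
    unfolding admissible_of_size_eq[symmetric] by (simp add: conj_commute eq_commute)
  also have "\<dots> = (\<Sum>xs\<in>admissible_of_size N. of_bool (j = num_color Color_b xs \<and> i = num_color Color_a xs))"
    using finite_admissible_of_size by (simp add: Int_def)
  finally show "tail_gf 0 $ N $ j $ i = (\<Sum>xs\<in>admissible_of_size N.
     (ser_a ^ num_color Color_a xs * ser_b ^ num_color Color_b xs * ser_q ^ N) $ N) $ j $ i"
    by (simp add: fps_sum_nth monomial_nth)
qed

theorem theorem1p10:
  shows "((\<lambda>(n, k, i, j). of_nat (C3 n k i j) * ser_a ^ i * ser_b ^ j * ser_q ^ n) has_sum
          (qpoch_inf (- ser_q) ser_q * qpoch_inf (- (ser_a * ser_q)) ser_q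
             * qpoch_inf (- (ser_b * ser_q)) ser_q
           / qpoch_inf (ser_a * ser_b * ser_q) (ser_q ^ 2)))
         (UNIV :: (nat \<times> nat \<times> nat \<times> nat) set)"
  unfolding has_sum_def tail_gf_0[symmetric]
proof (rule tendsto_fpsI)
  fix N
  let ?f = "\<lambda>(n, k, i, j). of_nat (C3 n k i j) * ser_a ^ i * ser_b ^ j * ser_q ^ n"
  let ?m = "\<lambda>xs. ser_a ^ num_color Color_a xs * ser_b ^ num_color Color_b xs * ser_q ^ N"
  \<comment> \<open>The finitely many statistics occurring in size \<open>N\<close>; every finite
    index set containing them yields the same coefficient of \<open>q^N\<close>.\<close>
  let ?B = "stats ` admissible_of_size N"
  have zero: "?f p $ N = 0" if "p \<notin> ?B" for p
  proof -
    obtain n k i j where p: "p = (n, k, i, j)" by (cases p) auto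
    show ?thesis
    proof (cases "n = N")
      case True
      then have empty: "{xs \<in> admissible_of_size n. stats xs = (n, k, i, j)} = {}" using that p by force
      show ?thesis by (simp only: p prod.case C3_eq empty card.empty) simp
    next
      case False
      have "(ser_a ^ i * ser_b ^ j * ser_q ^ n) $ N = 0"
        by (intro fps_ext) (simp add: monomial_nth False[symmetric])
      then show ?thesis by (simp add: p of_nat_mult_nth mult.assoc)
    qed
  qed
  have block: "?f p = (\<Sum>xs\<in>{xs \<in> admissible_of_size N. stats xs = p}. ?m xs)" if "p \<in> ?B" for p
  proof -
    from that obtain k i j where p: "p = (N, k, i, j)" by (auto simp: stats_def admissible_of_size_def)
    have "(\<Sum>xs\<in>{xs \<in> admissible_of_size N. stats xs = p}. ?m xs) =
        (\<Sum>xs\<in>{xs \<in> admissible_of_size N. stats xs = p}. ser_a ^ i * ser_b ^ j * ser_q ^ N)"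
      by (rule sum.cong) (auto simp: p stats_def)
    then show ?thesis by (simp add: p C3_eq mult.assoc)
  qed
  have "sum ?f Y $ N = tail_gf 0 $ N" if Y: "finite Y" "?B \<subseteq> Y" for Y
  proof -
    have "sum ?f Y $ N = (\<Sum>p\<in>?B. ?f p $ N)"
      unfolding fps_sum_nth using Y zero by (intro sum.mono_neutral_right) auto
    also have "\<dots> = (\<Sum>p\<in>?B. \<Sum>xs\<in>{xs \<in> admissible_of_size N. stats xs = p}. ?m xs) $ N"
      unfolding fps_sum_nth by (rule sum.cong[OF refl]) (simp only: block fps_sum_nth)
    also have "(\<Sum>p\<in>?B. \<Sum>xs\<in>{xs \<in> admissible_of_size N. stats xs = p}. ?m xs) = (\<Sum>xs\<in>admissible_of_size N. ?m xs)"
      by (rule sum.image_gen[symmetric]) (rule finite_admissible_of_size)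
    finally show ?thesis by (simp only: tail_gf_0_nth fps_sum_nth)
  qed
  then show "eventually (\<lambda>Y. sum ?f Y $ N = tail_gf 0 $ N) (finite_subsets_at_top UNIV)"
    unfolding eventually_finite_subsets_at_top
    using finite_admissible_of_size by (intro exI[of _ ?B]) auto
qed

end
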